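(* Let $n\ge 1$, $\gamma\in\mathbb{R}$, $\alpha>1$, $s\in\mathbb{R}$, $q\in[1,\infty]$, $r\in(0,\infty]$ and $T>0$. Assume $$\gamma>-\min(2,n),\qquad \alpha\ge \max\Big(1,1+\frac{\gamma}{n}\Big),\qquad \frac{\gamma}{\alpha-1}\le s\le n,\qquad \alpha\le q\le\infty,\qquad 0<r\le\infty,$$ and assume moreover the exponent conditions $$\text{(a) either } \frac sn+\frac1q>0, \text{ or } \frac sn+\frac1q=0 \text{ and } r=\infty;\qquad \text{(b) either } \frac sn+\frac1q<1, \text{ or } \frac sn+\frac1q=1 \text{ and } r\le1.$$ Put $q_c=\frac{n(\alpha-1)}{2+\gamma}$ and $Q_c=\frac{n\alpha}{n+\gamma}$. Suppose that either (i) $\frac sn+\frac1q<\min\big(\frac1{q_c},\frac1{Q_c}\big)$, or (ii) $\frac sn+\frac1q=\frac1{Q_c}<\frac1{q_c}$ and $r\le\alpha$. Then solutions of the Hardy–Hénon parabolic equation in $L^\infty(0,T;\dot K^s_{q,r}(\mathbb{R}^n))$ are unique: if $u_1,u_2\in L^\infty(0,T;\dot K^s_{q,r}(\mathbb{R}^n))$ are both solutions with the same initial datum $u_0$, then $u_1(t)=u_2(t)$ for almost every $t\in(0,T)$.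
   Context: For $j\in\mathbb{Z}$ let $A_j=\{x\in\mathbb{R}^n: 2^{j-1}\le|x|<2^j\}$. For $s\in\mathbb{R}$ and $0<q,r\le\infty$, the homogeneous Herz space $\dot K^s_{q,r}(\mathbb{R}^n)$ is the space of measurable $f$ with finite quasi-norm $\|f\|_{\dot K^s_{q,r}}=\big(\sum_{j\in\mathbb{Z}}[2^{js}\|f\chi_{A_j}\|_{L^q}]^r\big)^{1/r}$ (with the usual supremum modification if $r=\infty$). The heat semigroup is $e^{t\Delta}f(x)=(4\pi t)^{-n/2}\int_{\mathbb{R}^n}e^{-|x-y|^2/(4t)}f(y)\,dy$. The Hardy–Hénon parabolic equation is $\partial_t u-\Delta u=|x|^\gamma|u|^{\alpha-1}u$ on $(0,\infty)\times\mathbb{R}^n$, $u(0)=u_0$; a solution on $(0,T)$ with initial datum $u_0$ means a function $u$ satisfying the Duhamel integral equation $u(t)=e^{t\Delta}u_0+\int_0^t e^{(t-\tau)\Delta}\big[|\cdot|^\gamma|u(\tau)|^{\alpha-1}u(\tau)\big]\,d\tau$ for $t\in(0,T)$. *)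

theory Defs
  imports "HOL-Analysis.Analysis"
begin

text \<open>Real powers on ennreal (used only with positive exponents).\<close>
definition enn_powr :: "ennreal \<Rightarrow> real \<Rightarrow> ennreal" where
  "enn_powr x p = (if x = \<infinity> then \<infinity> else ennreal (enn2real x powr p))"

definition annulus :: "int \<Rightarrow> 'a::euclidean_space set" where
  "annulus j = {x. 2 powr (real_of_int j - 1) \<le> norm x \<and> norm x < 2 powr (real_of_int j)}"

definition Lq_norm :: "ereal \<Rightarrow> ('a::euclidean_space \<Rightarrow> real) \<Rightarrow> ennreal" where
  "Lq_norm q f =
     (if q = \<infinity> then Inf {C. AE x in lborel. ennreal \<bar>f x\<bar> \<le> C}
      else enn_powr (\<integral>\<^sup>+ x. ennreal (\<bar>f x\<bar> powr real_of_ereal q) \<partial>lborel) (1 / real_of_ereal q))"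

definition herz_norm :: "real \<Rightarrow> ereal \<Rightarrow> ereal \<Rightarrow> ('a::euclidean_space \<Rightarrow> real) \<Rightarrow> ennreal" where
  "herz_norm s q r f =
     (if r = \<infinity> then
        (SUP j::int. ennreal (2 powr (real_of_int j * s)) * Lq_norm q (\<lambda>x. f x * indicator (annulus j) x))
      else enn_powr
        (\<integral>\<^sup>+ j. enn_powr (ennreal (2 powr (real_of_int j * s)) *
                   Lq_norm q (\<lambda>x. f x * indicator (annulus j) x)) (real_of_ereal r)
              \<partial>count_space (UNIV :: int set))
        (1 / real_of_ereal r))"

definition herz_space :: "real \<Rightarrow> ereal \<Rightarrow> ereal \<Rightarrow> ('a::euclidean_space \<Rightarrow> real) set" where
  "herz_space s q r = {f. f \<in> borel_measurable lborel \<and> herz_norm s q r f < \<infinity>}"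

definition Linf_herz :: "real \<Rightarrow> real \<Rightarrow> ereal \<Rightarrow> ereal \<Rightarrow> (real \<Rightarrow> 'a::euclidean_space \<Rightarrow> real) set" where
  "Linf_herz T s q r = {u. (\<lambda>(t, x). u t x) \<in> borel_measurable (lborel \<Otimes>\<^sub>M lborel) \<and>
      (\<exists>C::real. AE t in lborel. t \<in> {0<..<T} \<longrightarrow> herz_norm s q r (u t) \<le> ennreal C)}"

definition heat_kernel :: "real \<Rightarrow> 'a::euclidean_space \<Rightarrow> real" where
  "heat_kernel t z = (4 * pi * t) powr (- real DIM('a) / 2) * exp (- (norm z)\<^sup>2 / (4 * t))"

definition heat :: "real \<Rightarrow> ('a::euclidean_space \<Rightarrow> real) \<Rightarrow> 'a \<Rightarrow> real" where
  "heat t f x = (\<integral> y. heat_kernel t (x - y) * f y \<partial>lborel)"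

definition hh_nonlin :: "real \<Rightarrow> real \<Rightarrow> 'a::real_normed_vector \<Rightarrow> real \<Rightarrow> real" where
  "hh_nonlin \<gamma> \<alpha> y v = norm y powr \<gamma> * \<bar>v\<bar> powr (\<alpha> - 1) * v"

definition duhamel_integrand ::
  "real \<Rightarrow> real \<Rightarrow> (real \<Rightarrow> 'a::euclidean_space \<Rightarrow> real) \<Rightarrow> real \<Rightarrow> 'a \<Rightarrow> real \<times> 'a \<Rightarrow> real" where
  "duhamel_integrand \<gamma> \<alpha> u t x = (\<lambda>(\<tau>, y). indicator {0<..<t} \<tau> *
       heat_kernel (t - \<tau>) (x - y) * hh_nonlin \<gamma> \<alpha> y (u \<tau> y))"

definition hh_solution ::
  "real \<Rightarrow> real \<Rightarrow> real \<Rightarrow> ('a::euclidean_space \<Rightarrow> real) \<Rightarrow> (real \<Rightarrow> 'a \<Rightarrow> real) \<Rightarrow> bool" where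
  "hh_solution \<gamma> \<alpha> T u0 u \<longleftrightarrow>
     (\<forall>t \<in> {0<..<T}. AE x in lborel.
        integrable lborel (\<lambda>y. heat_kernel t (x - y) * u0 y) \<and>
        integrable (lborel \<Otimes>\<^sub>M lborel) (duhamel_integrand \<gamma> \<alpha> u t x) \<and>
        u t x = heat t u0 x + (\<integral> p. duhamel_integrand \<gamma> \<alpha> u t x p \<partial>(lborel \<Otimes>\<^sub>M lborel)))"

end

theory Submission
  imports Defs
begin

text \<open>
  Put \<open>D = |x|\<^sup>\<gamma> (|u\<^sub>1|\<^sup>\<alpha>\<^sup>-\<^sup>1 u\<^sub>1 - |u\<^sub>2|\<^sup>\<alpha>\<^sup>-\<^sup>1 u\<^sub>2)\<close> and \<open>\<Phi>(t) = \<integral> exp(-|x|) |D(t,x)| dx\<close>.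
  Instead of estimating \<open>u\<^sub>1 - u\<^sub>2\<close> in a Herz norm, one estimates \<open>\<Phi>\<close>: since \<open>|D| \<le> V |u\<^sub>1 - u\<^sub>2|\<close> with
  \<open>V = \<alpha> |x|\<^sup>\<gamma> (|u\<^sub>1|\<^sup>\<alpha>\<^sup>-\<^sup>1 + |u\<^sub>2|\<^sup>\<alpha>\<^sup>-\<^sup>1)\<close>, Duhamel's formula and Tonelli's theorem reduce
  \<open>\<Phi>(t) \<le> C \<integral>\<^sub>0\<^sup>t (t-\<tau>)\<^sup>-\<^sup>\<theta> \<Phi>(\<tau>) d\<tau>\<close>, \<open>\<theta> < 1\<close>, to a bound for
  \<open>\<integral> V(t,x) G\<^bsub>t-\<tau>\<^esub>(x-y) exp(|y|-|x|) dx\<close>, uniform in \<open>y\<close>, where \<open>G\<close> is the heat kernel. The condition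
  involving \<open>q\<^sub>c\<close> says that \<open>V\<close> is locally better than \<open>L\<^bsup>n/2\<^esup>\<close>, and \<open>s \<ge> \<gamma>/(\<alpha>-1)\<close> controls \<open>V\<close> at infinity;
  the condition involving \<open>Q\<^sub>c\<close> (with \<open>r \<le> \<alpha>\<close> in the equality case) makes \<open>\<Phi>\<close> bounded. A singular Gronwall
  argument then gives \<open>\<Phi> = 0\<close>.\<close>

subsection \<open>Dyadic annuli\<close>

text \<open>Raise u \<le> exp u, at u = x / (2 * p), to the power p. Only half of the exponential is
  spent because the inner radius of an annulus is half of its outer radius.\<close>

lemma powr_le_exp_half:
  fixes p :: real
  assumes "p > 0"
  shows "\<exists>C>0. \<forall>x>0. x powr p \<le> C * exp (x / 2)"
proof (intro exI[of _ "(2 * p) powr p"] conjI allI impI)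
  show "(2 * p) powr p > 0" using assms by simp
  fix x :: real assume x: "x > 0"
  have "x / (2 * p) \<le> exp (x / (2 * p))"
    using exp_ge_add_one_self[of "x / (2 * p)"] by linarith
  then have "(x / (2 * p)) powr p \<le> exp (x / (2 * p)) powr p"
    using x assms by (intro powr_mono2) auto
  also have "\<dots> = exp (x / 2)"
    using assms by (simp add: powr_def)
  finally show "x powr p \<le> (2 * p) powr p * exp (x / 2)"
    using x assms by (simp add: powr_divide field_simps)
qed

text \<open>A two-sided geometric series. For uniformity in the real centre L, replace L by its
  floor: each distance changes by at most 1, which costs the factor \<open>2 powr d\<close>, and
  translating the integers reduces to the centre 0. Later the centre is the dyadic scale of a point
  y.\<close>

lemma nn_integral_int_geometric:
  fixes d :: real
  assumes "d > 0"
  shows "\<exists>C\<ge>0. \<forall>L::real.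
    (\<integral>\<^sup>+k. ennreal (2 powr (- d * \<bar>real_of_int k - L\<bar>)) \<partial>count_space UNIV) \<le> ennreal C"
proof -
  let ?S = "\<integral>\<^sup>+k. ennreal (2 powr (- d * \<bar>real_of_int k\<bar>)) \<partial>count_space UNIV"
  let ?N = "\<integral>\<^sup>+n. ennreal (2 powr (- d * real n)) \<partial>count_space UNIV"
  have geo: "(\<lambda>n. 2 powr (- d * real n)) = (\<lambda>n. (2 powr - d) ^ n)"
    by (simp add: powr_realpow[symmetric] powr_powr)
  have q: "norm (2 powr (- d)) < (1::real)"
    using assms by (simp add: powr_less_one)
  have "summable (\<lambda>n. 2 powr (- d * real n))"
    unfolding geo using q by (rule summable_geometric)
  then have N: "?N < \<infinity>"
    unfolding nn_integral_count_space_nat by (subst suminf_ennreal2) auto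
  \<comment> \<open>Zero lies in both half-lines; counting it twice is harmless in an upper
    bound.\<close>
  have "?S \<le> (\<integral>\<^sup>+k. ennreal (2 powr (- d * \<bar>real_of_int k\<bar>)) * indicator (range int) k
      + ennreal (2 powr (- d * \<bar>real_of_int k\<bar>)) * indicator (range (\<lambda>n. - int n)) k \<partial>count_space UNIV)"
  proof (rule nn_integral_mono)
    fix k :: int
    have "k \<in> range int \<or> k \<in> range (\<lambda>n. - int n)"
      by (metis int_cases2 rangeI)
    then show "ennreal (2 powr (- d * \<bar>real_of_int k\<bar>))
      \<le> ennreal (2 powr (- d * \<bar>real_of_int k\<bar>)) * indicator (range int) k
      + ennreal (2 powr (- d * \<bar>real_of_int k\<bar>)) * indicator (range (\<lambda>n. - int n)) k"
      by (auto simp: indicator_def)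
  qed
  also have "\<dots> = (\<integral>\<^sup>+k. ennreal (2 powr (- d * \<bar>real_of_int k\<bar>)) \<partial>count_space (range int))
     + (\<integral>\<^sup>+k. ennreal (2 powr (- d * \<bar>real_of_int k\<bar>)) \<partial>count_space (range (\<lambda>n. - int n)))"
    by (subst nn_integral_add) (auto simp: nn_integral_count_space_indicator)
  also have "(\<integral>\<^sup>+k. ennreal (2 powr (- d * \<bar>real_of_int k\<bar>)) \<partial>count_space (range int)) = ?N"
    by (subst nn_integral_bij_count_space[symmetric, where g = int and A = UNIV])
      (auto simp: bij_betw_def)
  also have "(\<integral>\<^sup>+k. ennreal (2 powr (- d * \<bar>real_of_int k\<bar>)) \<partial>count_space (range (\<lambda>n. - int n))) = ?N"
    by (subst nn_integral_bij_count_space[symmetric, where g = "\<lambda>n. - int n" and A = UNIV])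
      (auto simp: bij_betw_def inj_on_def)
  finally have S: "?S < \<infinity>" using N by (simp add: ennreal_add_less_top less_le_trans le_less_trans)
  show ?thesis
  proof (intro exI[of _ "enn2real (ennreal (2 powr d) * ?S)"] conjI allI)
    fix L :: real
    have "(\<integral>\<^sup>+k. ennreal (2 powr (- d * \<bar>real_of_int k - L\<bar>)) \<partial>count_space UNIV)
      \<le> (\<integral>\<^sup>+k. ennreal (2 powr d) * ennreal (2 powr (- d * \<bar>real_of_int (k - \<lfloor>L\<rfloor>)\<bar>)) \<partial>count_space UNIV)"
    proof (rule nn_integral_mono)
      fix k :: int
      have "\<bar>real_of_int (k - \<lfloor>L\<rfloor>)\<bar> \<le> \<bar>real_of_int k - L\<bar> + 1"
        by simp linarith
      then have "- d * \<bar>real_of_int k - L\<bar> \<le> d + - d * \<bar>real_of_int (k - \<lfloor>L\<rfloor>)\<bar>"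
        using assms mult_left_mono[of _ _ d] by (fastforce simp: algebra_simps)
      then show "ennreal (2 powr (- d * \<bar>real_of_int k - L\<bar>))
        \<le> ennreal (2 powr d) * ennreal (2 powr (- d * \<bar>real_of_int (k - \<lfloor>L\<rfloor>)\<bar>))"
        by (simp only: ennreal_mult[symmetric] powr_ge_zero powr_add[symmetric]) (intro ennreal_leI powr_mono, auto)
    qed
    also have "\<dots> = ennreal (2 powr d) * (\<integral>\<^sup>+k. ennreal (2 powr (- d * \<bar>real_of_int (k - \<lfloor>L\<rfloor>)\<bar>)) \<partial>count_space UNIV)"
      by (rule nn_integral_cmult) simp
    also have "(\<integral>\<^sup>+k. ennreal (2 powr (- d * \<bar>real_of_int (k - \<lfloor>L\<rfloor>)\<bar>)) \<partial>count_space UNIV) = ?S"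
      by (rule nn_integral_bij_count_space[where g = "\<lambda>k. k - \<lfloor>L\<rfloor>"])
        (auto intro!: bij_betwI[where g = "\<lambda>k. k + \<lfloor>L\<rfloor>"])
    finally show "(\<integral>\<^sup>+k. ennreal (2 powr (- d * \<bar>real_of_int k - L\<bar>)) \<partial>count_space UNIV)
      \<le> ennreal (enn2real (ennreal (2 powr d) * ?S))"
      using S by (simp add: ennreal_mult_less_top)
  qed simp
qed

lemma annulus_measurable [measurable]: "annulus k \<in> sets borel"
proof -
  have "annulus k = {x \<in> space (borel :: 'a measure). 2 powr (real_of_int k - 1) \<le> norm x \<and> norm x < 2 powr real_of_int k}"
    by (simp add: annulus_def)
  also have "\<dots> \<in> sets borel" by measurable
  finally show ?thesis .
qed

text \<open>Annuli are indexed by their outer radius, hence the shift by one against the floor of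
  the logarithm.\<close>

lemma annulus_index:
  fixes x :: "'a::euclidean_space"
  assumes "x \<noteq> 0"
  shows "x \<in> annulus k \<longleftrightarrow> k = \<lfloor>log 2 (norm x)\<rfloor> + 1"
proof -
  have "x \<in> annulus k \<longleftrightarrow> real_of_int (k - 1) \<le> log 2 (norm x) \<and> log 2 (norm x) < real_of_int (k - 1) + 1"
    using assms by (simp add: annulus_def le_log_iff log_less_iff)
  also have "\<dots> \<longleftrightarrow> k = \<lfloor>log 2 (norm x)\<rfloor> + 1"
    using floor_eq_iff[of "log 2 (norm x)" "k - 1"] by auto
  finally show ?thesis .
qed

lemma annulus_emeasure_le:
  "emeasure lborel (annulus k :: 'a::euclidean_space set)
    \<le> ennreal (unit_ball_vol (real DIM('a)) * 2 powr (real_of_int k * real DIM('a)))"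
proof -
  have "emeasure lborel (annulus k :: 'a set) \<le> emeasure lborel (cball (0::'a) (2 powr real_of_int k))"
    by (intro emeasure_mono) (auto simp: annulus_def)
  also have "\<dots> = ennreal (unit_ball_vol (real DIM('a)) * 2 powr (real_of_int k * real DIM('a)))"
    by (subst emeasure_cball) (auto simp: powr_realpow[symmetric] powr_powr)
  finally show ?thesis .
qed

text \<open>Tonelli, with the sum over the integers read as an integral for counting measure. Every
  nonzero point lies in exactly one annulus, and the origin is a null set.\<close>

lemma nn_integral_annuli:
  fixes g :: "'a::euclidean_space \<Rightarrow> ennreal"
  assumes [measurable]: "g \<in> borel_measurable borel"
  shows "(\<integral>\<^sup>+x. g x \<partial>lborel) = (\<integral>\<^sup>+k. (\<integral>\<^sup>+x. g x * indicator (annulus k) x \<partial>lborel) \<partial>count_space UNIV)"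
proof -
  interpret Z: sigma_finite_measure "count_space (UNIV :: int set)"
    by (rule sigma_finite_measure_count_space)
  interpret P: pair_sigma_finite "count_space (UNIV :: int set)" "lborel :: 'a measure" ..
  have "(\<integral>\<^sup>+k. (\<integral>\<^sup>+x. g x * indicator (annulus k) x \<partial>lborel) \<partial>count_space UNIV)
    = (\<integral>\<^sup>+x. (\<integral>\<^sup>+k. g x * indicator (annulus k) x \<partial>count_space UNIV) \<partial>lborel)"
    by (rule P.Fubini'[symmetric]) (auto intro!: measurable_pair_measure_countable1)
  also have "\<dots> = (\<integral>\<^sup>+x. g x \<partial>lborel)"
  proof (rule nn_integral_cong_AE)
    have "AE x in lborel. x \<noteq> (0::'a)" by (rule AE_lborel_singleton)
    then show "AE x in lborel. (\<integral>\<^sup>+k. g x * indicator (annulus k) x \<partial>count_space UNIV) = g x"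
    proof eventually_elim
      case (elim x)
      have "(\<integral>\<^sup>+k. g x * indicator (annulus k) x \<partial>count_space UNIV)
        = (\<integral>\<^sup>+k. g x * indicator {\<lfloor>log 2 (norm x)\<rfloor> + 1} k \<partial>count_space UNIV)"
        by (intro nn_integral_cong) (auto simp: annulus_index[OF elim] indicator_def)
      then show ?case by (simp add: nn_integral_cmult_indicator)
    qed
  qed
  finally show ?thesis ..
qed

subsection \<open>Lebesgue and Herz norms on annuli\<close>

lemma enn_powr_ennreal: "0 \<le> c \<Longrightarrow> enn_powr (ennreal c) p = ennreal (c powr p)"
  by (simp add: enn_powr_def)

lemma enn_powr_inverse_le:
  assumes "enn_powr X (1 / p) \<le> ennreal c" "p > 0" "c \<ge> 0"
  shows "X \<le> ennreal (c powr p)"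
proof (cases X)
  case (real x)
  then have "x powr (1 / p) \<le> c"
    using assms by (simp add: enn_powr_ennreal)
  then have "(x powr (1 / p)) powr p \<le> c powr p"
    using assms by (intro powr_mono2) auto
  then show ?thesis
    using real assms by (simp add: powr_powr ennreal_leI)
next
  case top
  then show ?thesis using assms by (simp add: enn_powr_def top_unique)
qed

text \<open>The norm is an infimum of essential bounds, so each L + 1 / (m + 1) is one; intersecting
  countably many sets of full measure gives L itself.\<close>

lemma Lq_norm_infty_AE:
  assumes "Lq_norm \<infinity> f \<le> ennreal L" "L \<ge> 0"
  shows "AE x in lborel. \<bar>f x\<bar> \<le> L"
proof -
  have *: "AE x in lborel. \<bar>f x\<bar> < L + 1 / real (Suc m)" for m
  proof -
    have "Lq_norm \<infinity> f < ennreal (L + 1 / real (Suc m))"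
      using assms by (intro le_less_trans[OF assms(1)]) (simp add: ennreal_less_iff)
    then obtain c where c: "AE x in lborel. ennreal \<bar>f x\<bar> \<le> c" "c < ennreal (L + 1 / real (Suc m))"
      by (auto simp: Lq_norm_def Inf_less_iff)
    from c(1) show ?thesis
    proof eventually_elim
      case (elim x)
      then have "ennreal \<bar>f x\<bar> < ennreal (L + 1 / real (Suc m))" using c(2) by (rule le_less_trans)
      then show ?case by (simp add: ennreal_less_iff)
    qed
  qed
  then have "AE x in lborel. \<forall>m. \<bar>f x\<bar> < L + 1 / real (Suc m)" by (simp add: AE_all_countable)
  then show ?thesis
  proof eventually_elim
    case (elim x)
    show ?case
    proof (rule field_le_epsilon)
      fix e :: real assume "e > 0"
      then obtain m where "1 / real (Suc m) < e" using nat_approx_posE by blast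
      then show "\<bar>f x\<bar> \<le> L + e" using elim[rule_format, of m] by linarith
    qed
  qed
qed

lemma Lq_norm_finite_integral:
  assumes "Lq_norm (ereal p) f \<le> ennreal L" "L \<ge> 0" "p > 0"
  shows "(\<integral>\<^sup>+x. ennreal (\<bar>f x\<bar> powr p) \<partial>lborel) \<le> ennreal (L powr p)"
  using assms by (intro enn_powr_inverse_le) (auto simp: Lq_norm_def)

lemma Lq_norm_zero_AE:
  assumes "Lq_norm q f \<le> 0" "q > 0" and [measurable]: "f \<in> borel_measurable borel"
  shows "AE x in lborel. f x = 0"
proof (cases q)
  case (real p)
  then have "(\<integral>\<^sup>+x. ennreal (\<bar>f x\<bar> powr p) \<partial>lborel) \<le> ennreal (0 powr p)"
    using assms by (intro Lq_norm_finite_integral) auto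
  then have "AE x in lborel. ennreal (\<bar>f x\<bar> powr p) = 0"
    by (simp add: nn_integral_0_iff_AE)
  then show ?thesis by eventually_elim (auto simp: ennreal_eq_0_iff)
next
  case PInf
  then show ?thesis using Lq_norm_infty_AE[of f 0] assms by auto
qed (use assms in auto)

text \<open>Hoelder's inequality with exponents 1 / \<kappa> and 1 / (1 - \<kappa>), where \<kappa>
  = a / q is 0 for q = \<infinity>. It comes from integrating Young's inequality for the functions
  normalised by L and J, so upper bounds for the norms suffice.\<close>

lemma Lq_Holder:
  fixes f h :: "'a::euclidean_space \<Rightarrow> real" and a L J :: real and q :: ereal
  defines "\<kappa> \<equiv> a * real_of_ereal (1 / q)"
  assumes [measurable]: "f \<in> borel_measurable borel" "h \<in> borel_measurable borel" "A \<in> sets borel"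
    and h: "\<And>x. h x \<ge> 0" and a: "a > 0" "ereal a < q"
    and L: "Lq_norm q (\<lambda>x. f x * indicator A x) \<le> ennreal L" "L \<ge> 0"
    and J: "(\<integral>\<^sup>+x. ennreal (h x powr (1 / (1 - \<kappa>))) * indicator A x \<partial>lborel) \<le> ennreal J" "J > 0"
  shows "(\<integral>\<^sup>+x. ennreal (\<bar>f x\<bar> powr a * h x) * indicator A x \<partial>lborel) \<le> ennreal (L powr a * J powr (1 - \<kappa>))"
proof -
  \<comment> \<open>L = 0 is split off because the normalisation below divides by
    \<open>L powr p\<close>.\<close>
  have AE0: "AE x in lborel. f x * indicator A x = 0" if "L = 0"
    using L that a by (intro Lq_norm_zero_AE[of q]) (auto simp: zero_ennreal_def[symmetric] intro: less_trans[of 0 "ereal a"])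
  consider (zero) "L = 0" | (inf) "L > 0" "q = \<infinity>" | (fin) p where "L > 0" "q = ereal p" "p > a"
    using L a by (cases q) force+
  then show ?thesis
  proof cases
    case zero
    have "(\<integral>\<^sup>+x. ennreal (\<bar>f x\<bar> powr a * h x) * indicator A x \<partial>lborel) = 0"
      using AE0[OF zero] a by (subst nn_integral_0_iff_AE) (auto simp: indicator_def elim!: eventually_mono)
    then show ?thesis by simp
  next
    case inf
    then have k: "\<kappa> = 0" by (simp add: \<kappa>_def)
    have "(\<integral>\<^sup>+x. ennreal (\<bar>f x\<bar> powr a * h x) * indicator A x \<partial>lborel)
      \<le> (\<integral>\<^sup>+x. ennreal (L powr a) * (ennreal (h x) * indicator A x) \<partial>lborel)"
    proof (rule nn_integral_mono_AE)
      have "AE x in lborel. \<bar>f x * indicator A x\<bar> \<le> L"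
        using L inf by (intro Lq_norm_infty_AE) auto
      then show "AE x in lborel. ennreal (\<bar>f x\<bar> powr a * h x) * indicator A x
        \<le> ennreal (L powr a) * (ennreal (h x) * indicator A x)"
      proof eventually_elim
        case (elim x)
        show ?case
        proof (cases "x \<in> A")
          case True
          then have "\<bar>f x\<bar> powr a \<le> L powr a"
            using elim a by (intro powr_mono2) auto
          then show ?thesis
            using True h by (simp add: ennreal_mult[symmetric] mult_right_mono)
        qed simp
      qed
    qed
    also have "\<dots> = ennreal (L powr a) * (\<integral>\<^sup>+x. ennreal (h x) * indicator A x \<partial>lborel)"
      by (rule nn_integral_cmult) simp
    also have "\<dots> \<le> ennreal (L powr a) * ennreal J"
      using J h by (intro mult_left_mono) (simp_all add: k)
    finally show ?thesis using J by (simp add: k ennreal_mult)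
  next
    case (fin p)
    have k: "\<kappa> = a / p" "0 < \<kappa>" "\<kappa> < 1"
      using fin a by (auto simp: \<kappa>_def one_ereal_def)
    define F where "F x = \<bar>f x * indicator A x\<bar> powr p" for x
    define H where "H x = h x powr (1 / (1 - \<kappa>))" for x
    have [measurable]: "F \<in> borel_measurable borel" "H \<in> borel_measurable borel"
      unfolding F_def H_def by measurable
    have F: "(\<integral>\<^sup>+x. ennreal (F x) \<partial>lborel) \<le> ennreal (L powr p)"
      unfolding F_def using L fin a by (intro Lq_norm_finite_integral) auto
    let ?c = "L powr a * J powr (1 - \<kappa>)"
    \<comment> \<open>Young's inequality for \<open>F x / L powr p\<close> and
      \<open>H x / J\<close> with weights \<kappa> and 1 - \<kappa>, multiplied back by
      \<open>?c\<close>. It is applied to positive numbers, so zeros of f and h are treated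
      apart.\<close>
    have pw: "\<bar>f x\<bar> powr a * h x \<le> ?c * \<kappa> / L powr p * F x + ?c * (1 - \<kappa>) / J * H x" if "x \<in> A" for x
    proof (cases "f x = 0 \<or> h x = 0")
      case True
      have "F x \<ge> 0" "H x \<ge> 0" by (auto simp: F_def H_def)
      then have "0 \<le> ?c * \<kappa> / L powr p * F x + ?c * (1 - \<kappa>) / J * H x"
        using k J by (intro add_nonneg_nonneg mult_nonneg_nonneg divide_nonneg_nonneg) auto
      then show ?thesis using True a by auto
    next
      case False
      then have pos: "\<bar>f x\<bar> > 0" "h x > 0" using h[of x] by auto
      have "(F x / L powr p) powr \<kappa> * (H x / J) powr (1 - \<kappa>) \<le> \<kappa> * (F x / L powr p) + (1 - \<kappa>) * (H x / J)"
        using pos k fin J that by (intro Youngs_inequality_0) (auto simp: F_def H_def)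
      moreover have "(F x / L powr p) powr \<kappa> = \<bar>f x\<bar> powr a / L powr a"
        using pos k fin a that by (simp add: F_def powr_divide powr_powr)
      moreover have "(H x / J) powr (1 - \<kappa>) = h x / J powr (1 - \<kappa>)"
        using pos k(3) J by (simp add: H_def powr_divide powr_powr)
      ultimately have "\<bar>f x\<bar> powr a / L powr a * (h x / J powr (1 - \<kappa>)) \<le> \<kappa> * (F x / L powr p) + (1 - \<kappa>) * (H x / J)"
        by simp
      then have "?c * (\<bar>f x\<bar> powr a / L powr a * (h x / J powr (1 - \<kappa>))) \<le> ?c * (\<kappa> * (F x / L powr p) + (1 - \<kappa>) * (H x / J))"
        by (rule mult_left_mono) simp
      then show ?thesis using fin J by (simp add: field_simps)
    qed
    have "(\<integral>\<^sup>+x. ennreal (\<bar>f x\<bar> powr a * h x) * indicator A x \<partial>lborel)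
      \<le> (\<integral>\<^sup>+x. ennreal (?c * \<kappa> / L powr p) * ennreal (F x)
          + ennreal (?c * (1 - \<kappa>) / J) * (ennreal (H x) * indicator A x) \<partial>lborel)"
    proof (rule nn_integral_mono)
      fix x
      show "ennreal (\<bar>f x\<bar> powr a * h x) * indicator A x \<le> ennreal (?c * \<kappa> / L powr p) * ennreal (F x)
          + ennreal (?c * (1 - \<kappa>) / J) * (ennreal (H x) * indicator A x)"
      proof (cases "x \<in> A")
        case True
        have "F x \<ge> 0" "H x \<ge> 0" by (auto simp: F_def H_def)
        then show ?thesis
          using ennreal_leI[OF pw[OF True]] True k(2,3) J by (simp add: ennreal_mult[symmetric] ennreal_plus[symmetric] del: ennreal_plus)
      qed simp
    qed
    also have "\<dots> = ennreal (?c * \<kappa> / L powr p) * (\<integral>\<^sup>+x. ennreal (F x) \<partial>lborel)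
      + ennreal (?c * (1 - \<kappa>) / J) * (\<integral>\<^sup>+x. ennreal (H x) * indicator A x \<partial>lborel)"
      by (subst nn_integral_add) (auto simp: nn_integral_cmult)
    also have "\<dots> \<le> ennreal (?c * \<kappa> / L powr p) * ennreal (L powr p) + ennreal (?c * (1 - \<kappa>) / J) * ennreal J"
      using F J by (intro add_mono mult_left_mono) (auto simp: H_def)
    also have "\<dots> = ennreal (?c * \<kappa> / L powr p * L powr p + ?c * (1 - \<kappa>) / J * J)"
      using k(2,3) J by (simp add: ennreal_mult[symmetric] ennreal_plus[symmetric] del: ennreal_plus)
    \<comment> \<open>After integration both normalised functions have mass at most 1, and the
      weights \<kappa> and 1 - \<kappa> add up to 1.\<close>
    also have "?c * \<kappa> / L powr p * L powr p + ?c * (1 - \<kappa>) / J * J = ?c"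
      using fin J by (simp add: field_simps)
    finally show ?thesis .
  qed
qed

text \<open>Hoelder against the constant 1. The endpoint a = q is separate: there \<kappa> = 1, the
  conjugate exponent 1 / (1 - \<kappa>) degenerates, and the volume factor has exponent 0.\<close>

lemma Lq_power_integral:
  fixes f :: "'a::euclidean_space \<Rightarrow> real" and a L J :: real and q :: ereal
  assumes [measurable]: "f \<in> borel_measurable borel" "A \<in> sets borel"
    and a: "a > 0" "ereal a \<le> q"
    and L: "Lq_norm q (\<lambda>x. f x * indicator A x) \<le> ennreal L" "L \<ge> 0"
    and J: "emeasure lborel A \<le> ennreal J" "J > 0"
  shows "(\<integral>\<^sup>+x. ennreal (\<bar>f x\<bar> powr a) * indicator A x \<partial>lborel)
    \<le> ennreal (L powr a * J powr (1 - a * real_of_ereal (1 / q)))"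
proof (cases "ereal a = q")
  case True
  have "(\<integral>\<^sup>+x. ennreal (\<bar>f x\<bar> powr a) * indicator A x \<partial>lborel)
    = (\<integral>\<^sup>+x. ennreal (\<bar>f x * indicator A x\<bar> powr a) \<partial>lborel)"
    using a by (intro nn_integral_cong) (auto simp: indicator_def)
  also have "\<dots> \<le> ennreal (L powr a)"
    using L a True by (intro Lq_norm_finite_integral) auto
  finally show ?thesis using True[symmetric] a J by (simp add: one_ereal_def)
next
  case False
  then have "ereal a < q" using a by simp
  from Lq_Holder[of f "\<lambda>_. 1" A, OF _ _ _ _ a(1) this L _ J(2)] J show ?thesis by simp
qed

section \<open>Bounds on single annuli, and over all annuli, extracted from the Herz norm\<close>

lemma herz_norm_annulus:
  fixes f :: "'a::euclidean_space \<Rightarrow> real" and r :: ereal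
  assumes "herz_norm s q r f \<le> ennreal C" "C \<ge> 0" "r > 0"
  shows "ennreal (2 powr (real_of_int k * s)) * Lq_norm q (\<lambda>x. f x * indicator (annulus k) x) \<le> ennreal C"
proof -
  let ?a = "\<lambda>k. ennreal (2 powr (real_of_int k * s)) * Lq_norm q (\<lambda>x. f x * indicator (annulus k) x)"
  show ?thesis
  proof (cases r)
    case (real p)
    then have p: "p > 0" using assms by simp
    have "(\<integral>\<^sup>+j. enn_powr (?a j) p \<partial>count_space UNIV) \<le> ennreal (C powr p)"
      using assms real p by (intro enn_powr_inverse_le) (auto simp: herz_norm_def)
    moreover have "enn_powr (?a k) p \<le> (\<integral>\<^sup>+j. enn_powr (?a j) p \<partial>count_space UNIV)"
      by (rule nn_integral_ge_point) simp
    ultimately have *: "enn_powr (?a k) p \<le> ennreal (C powr p)" by order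
    show ?thesis
    proof (cases "?a k")
      case (real c)
      with * have "c powr p \<le> C powr p" by (simp add: enn_powr_ennreal)
      then have "c \<le> C" using p assms real by (meson powr_less_mono2 not_le)
      then show ?thesis using real by (simp add: ennreal_leI)
    next
      case top
      then show ?thesis using * by (simp add: enn_powr_def top_unique)
    qed
  next
    case PInf
    have "?a k \<le> (SUP k. ?a k)" by (rule SUP_upper) simp
    then show ?thesis using assms PInf by (simp add: herz_norm_def)
  qed (use assms in auto)
qed

text \<open>The inclusion of l^r in l^a: every term is at most C, so its a-th power is at most
  \<open>C powr (a - p)\<close> times its p-th power. This is how r \<le> \<alpha> enters the
  borderline case.\<close>

lemma herz_norm_summable:
  fixes f :: "'a::euclidean_space \<Rightarrow> real" and r :: ereal
  assumes C: "herz_norm s q r f \<le> ennreal C" "C \<ge> 0" and r: "r > 0" "r \<le> ereal a"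
  shows "(\<integral>\<^sup>+k. enn_powr (ennreal (2 powr (real_of_int k * s)) * Lq_norm q (\<lambda>x. f x * indicator (annulus k) x)) a
    \<partial>count_space UNIV) \<le> ennreal (C powr a)"
proof -
  let ?a = "\<lambda>k. ennreal (2 powr (real_of_int k * s)) * Lq_norm q (\<lambda>x. f x * indicator (annulus k) x)"
  obtain p where p: "r = ereal p" "p > 0" "p \<le> a" using r by (cases r) auto
  have "(\<integral>\<^sup>+k. enn_powr (?a k) a \<partial>count_space UNIV)
    \<le> (\<integral>\<^sup>+k. ennreal (C powr (a - p)) * enn_powr (?a k) p \<partial>count_space UNIV)"
  proof (rule nn_integral_mono)
    fix k :: int
    have *: "?a k \<le> ennreal C" using C r by (intro herz_norm_annulus)
    show "enn_powr (?a k) a \<le> ennreal (C powr (a - p)) * enn_powr (?a k) p"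
    proof (cases "?a k")
      case (real c)
      have "c \<le> C" using * real C by simp
      then have "c powr (a - p) * c powr p \<le> C powr (a - p) * c powr p"
        using real p by (intro mult_right_mono powr_mono2) auto
      then show ?thesis
        using real by (simp add: enn_powr_ennreal ennreal_mult[symmetric] powr_add[symmetric])
    next
      case top
      then show ?thesis using * by (simp add: top_unique)
    qed
  qed
  also have "\<dots> = ennreal (C powr (a - p)) * (\<integral>\<^sup>+k. enn_powr (?a k) p \<partial>count_space UNIV)"
    by (rule nn_integral_cmult) simp
  also have "\<dots> \<le> ennreal (C powr (a - p)) * ennreal (C powr p)"
    using C p by (intro mult_left_mono enn_powr_inverse_le[where p = p]) (auto simp: herz_norm_def)
  finally show ?thesis by (simp add: ennreal_mult[symmetric] powr_add[symmetric])
qed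

text \<open>For k \<le> 0 the exponential is at most 1 and the power already decays. For k > 0 the
  exponential beats the power 2 * \<mu>; one half of it cancels the growth and the other half is the
  decay. The shape with \<open>- 0\<close> matches \<open>nn_integral_int_geometric\<close> at L =
  0.\<close>

lemma annulus_exp_decay:
  fixes \<mu> :: real
  assumes "\<mu> > 0"
  shows "\<exists>C\<ge>0. \<forall>k::int. 2 powr (real_of_int k * \<mu>) * exp (- (2 powr (real_of_int k - 1)))
    \<le> C * 2 powr (- \<mu> * \<bar>real_of_int k - 0\<bar>)"
proof -
  obtain C where C: "C > 0" "\<And>x::real. x > 0 \<Longrightarrow> x powr (2 * \<mu>) \<le> C * exp (x / 2)"
    using powr_le_exp_half[of "2 * \<mu>"] assms by auto
  show ?thesis
  proof (intro exI[of _ "max 1 C"] conjI allI)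
    fix k :: int
    let ?x = "2 powr real_of_int k"
    have h: "2 powr (real_of_int k - 1) = ?x / 2"
      by (simp add: powr_diff)
    show "2 powr (real_of_int k * \<mu>) * exp (- (2 powr (real_of_int k - 1)))
      \<le> max 1 C * 2 powr (- \<mu> * \<bar>real_of_int k - 0\<bar>)"
    proof (cases "k \<le> 0")
      case True
      then have "2 powr (real_of_int k * \<mu>) * exp (- (2 powr (real_of_int k - 1)))
        \<le> 2 powr (- \<mu> * \<bar>real_of_int k - 0\<bar>) * 1"
        by (intro mult_mono) (auto simp: mult.commute)
      also have "\<dots> \<le> 2 powr (- \<mu> * \<bar>real_of_int k - 0\<bar>) * max 1 C"
        by (intro mult_left_mono) auto
      finally show ?thesis by (simp add: mult.commute)
    next
      case False
      have "?x powr \<mu> * ?x powr \<mu> \<le> C * exp (?x / 2)"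
        using C(2)[of ?x] by (simp add: powr_add[symmetric])
      then have "?x powr \<mu> * exp (- (?x / 2)) \<le> C * ?x powr (- \<mu>)"
        by (simp add: exp_minus powr_minus field_simps)
      also have "\<dots> \<le> max 1 C * ?x powr (- \<mu>)"
        by (intro mult_right_mono) auto
      finally show ?thesis using False unfolding h by (simp add: powr_powr mult.commute)
    qed
  qed simp
qed

text \<open>The sign of \<gamma> decides which edge of the annulus is extremal; the factor
  \<open>2 powr \<bar>\<gamma>\<bar>\<close> pays for the inner edge and covers both signs.\<close>

lemma norm_powr_annulus_le:
  fixes x :: "'a::euclidean_space"
  assumes "x \<in> annulus k"
  shows "norm x powr \<gamma> \<le> 2 powr \<bar>\<gamma>\<bar> * 2 powr (real_of_int k * \<gamma>)"
proof (cases "\<gamma> \<ge> 0")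
  case True
  have "norm x powr \<gamma> \<le> (2 powr real_of_int k) powr \<gamma>"
    using assms True by (intro powr_mono2) (auto simp: annulus_def)
  also have "\<dots> \<le> 2 powr \<bar>\<gamma>\<bar> * 2 powr (real_of_int k * \<gamma>)"
    using True by (simp add: powr_powr ge_one_powr_ge_zero)
  finally show ?thesis .
next
  case False
  have "norm x powr \<gamma> \<le> (2 powr (real_of_int k - 1)) powr \<gamma>"
    using assms False by (intro powr_mono2') (auto simp: annulus_def)
  also have "\<dots> = 2 powr \<bar>\<gamma>\<bar> * 2 powr (real_of_int k * \<gamma>)"
    using False by (simp add: powr_powr powr_add[symmetric] algebra_simps)
  finally show ?thesis .
qed

lemma Lq_norm_of_scaled_le:
  assumes "ennreal (2 powr (real_of_int k * s)) * X \<le> ennreal c" "c \<ge> 0"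
  shows "X \<le> ennreal (c * 2 powr (- real_of_int k * s))"
proof -
  have "X = ennreal (2 powr (- real_of_int k * s) * 2 powr (real_of_int k * s)) * X"
    by (simp add: powr_add[symmetric])
  also have "\<dots> = ennreal (2 powr (- real_of_int k * s)) * (ennreal (2 powr (real_of_int k * s)) * X)"
    by (subst ennreal_mult) (simp_all only: powr_ge_zero mult.assoc)
  also have "\<dots> \<le> ennreal (2 powr (- real_of_int k * s)) * ennreal c"
    using assms by (intro mult_left_mono) auto
  also have "\<dots> = ennreal (c * 2 powr (- real_of_int k * s))"
    using assms by (simp add: ennreal_mult[symmetric] mult.commute)
  finally show ?thesis .
qed

text \<open>\<mu> is the scaling exponent of the integral over annulus k: n (1 - a / q) from the
  volume in Hoelder, - a s from the Herz weight and \<gamma> from the power weight. If \<mu> > 0,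
  the sum is geometric near the origin and the exponential weight controls large annuli. If \<mu> =
  0, the sum converges because the a-th powers of the Herz terms are summable.\<close>

lemma herz_weighted_mass:
  fixes s \<gamma> a C :: real and q r :: ereal
  defines "\<mu> \<equiv> real DIM('a) * (1 - a * real_of_ereal (1 / q)) - a * s + \<gamma>"
  assumes a: "a > 0" "ereal a \<le> q" and r: "r > 0" and C: "C \<ge> 0"
    and \<mu>: "\<mu> > 0 \<or> \<mu> = 0 \<and> r \<le> ereal a"
  shows "\<exists>K\<ge>0. \<forall>f::'a::euclidean_space \<Rightarrow> real. f \<in> borel_measurable borel \<longrightarrow>
    herz_norm s q r f \<le> ennreal C \<longrightarrow>
    (\<integral>\<^sup>+x. ennreal (exp (- norm x) * norm x powr \<gamma> * \<bar>f x\<bar> powr a) \<partial>lborel) \<le> ennreal K"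
proof -
  define \<kappa> where "\<kappa> = a * real_of_ereal (1 / q)"
  define v where "v = unit_ball_vol (real DIM('a))"
  have v: "v > 0" by (simp add: v_def)
  define D where "D = 2 powr \<bar>\<gamma>\<bar> * v powr (1 - \<kappa>)"
  have D: "D \<ge> 0" by (simp add: D_def)
  \<comment> \<open>The bound c is left free: it is the common constant C when \<mu> > 0 and the
    actual k-th Herz term when \<mu> = 0.\<close>
  have piece: "(\<integral>\<^sup>+x. ennreal (exp (- norm x) * norm x powr \<gamma> * \<bar>f x\<bar> powr a) * indicator (annulus k) x \<partial>lborel)
      \<le> ennreal (D * c powr a * (2 powr (real_of_int k * \<mu>) * exp (- (2 powr (real_of_int k - 1)))))"
    if [measurable]: "f \<in> borel_measurable borel"
      and c: "ennreal (2 powr (real_of_int k * s)) * Lq_norm q (\<lambda>x. f x * indicator (annulus k) x) \<le> ennreal c" "c \<ge> 0"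
    for f :: "'a \<Rightarrow> real" and k c
  proof -
    let ?w = "exp (- (2 powr (real_of_int k - 1))) * (2 powr \<bar>\<gamma>\<bar> * 2 powr (real_of_int k * \<gamma>))"
    have "(\<integral>\<^sup>+x. ennreal (exp (- norm x) * norm x powr \<gamma> * \<bar>f x\<bar> powr a) * indicator (annulus k) x \<partial>lborel)
      \<le> (\<integral>\<^sup>+x. ennreal ?w * (ennreal (\<bar>f x\<bar> powr a) * indicator (annulus k) x) \<partial>lborel)"
    proof (rule nn_integral_mono)
      fix x :: 'a
      show "ennreal (exp (- norm x) * norm x powr \<gamma> * \<bar>f x\<bar> powr a) * indicator (annulus k) x
        \<le> ennreal ?w * (ennreal (\<bar>f x\<bar> powr a) * indicator (annulus k) x)"
      proof (cases "x \<in> annulus k")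
        case True
        have "exp (- norm x) * norm x powr \<gamma> \<le> ?w"
          using True by (intro mult_mono norm_powr_annulus_le) (auto simp: annulus_def)
        then show ?thesis using True
          by (simp add: ennreal_mult[symmetric] mult_right_mono ennreal_leI)
      qed simp
    qed
    also have "\<dots> = ennreal ?w * (\<integral>\<^sup>+x. ennreal (\<bar>f x\<bar> powr a) * indicator (annulus k) x \<partial>lborel)"
      by (rule nn_integral_cmult) simp
    also have "\<dots> \<le> ennreal ?w * ennreal ((c * 2 powr (- real_of_int k * s)) powr a
        * (v * 2 powr (real_of_int k * real DIM('a))) powr (1 - a * real_of_ereal (1 / q)))"
      using a c v Lq_norm_of_scaled_le[OF c] annulus_emeasure_le[of k, where ?'a = 'a]
      by (intro mult_left_mono Lq_power_integral) (auto simp: v_def)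
    also have "\<dots> = ennreal (D * c powr a * (2 powr (real_of_int k * \<mu>) * exp (- (2 powr (real_of_int k - 1)))))"
    proof -
      have "2 powr (real_of_int k * \<gamma>) * (2 powr (- real_of_int k * s)) powr a
        * (2 powr (real_of_int k * real DIM('a))) powr (1 - \<kappa>) = 2 powr (real_of_int k * \<mu>)"
        by (simp add: powr_powr powr_add[symmetric] \<mu>_def \<kappa>_def algebra_simps)
      then show ?thesis
        using c v by (simp add: ennreal_mult[symmetric] powr_mult D_def \<kappa>_def[symmetric] mult_ac)
    qed
    finally show ?thesis .
  qed
  show ?thesis
  proof (cases "\<mu> > 0")
    case True
    obtain C1 where C1: "C1 \<ge> 0" "\<And>k::int. 2 powr (real_of_int k * \<mu>) * exp (- (2 powr (real_of_int k - 1)))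
      \<le> C1 * 2 powr (- \<mu> * \<bar>real_of_int k - 0\<bar>)" using annulus_exp_decay[OF True] by auto
    obtain C2 where C2: "C2 \<ge> 0" "\<And>L::real.
      (\<integral>\<^sup>+k. ennreal (2 powr (- \<mu> * \<bar>real_of_int k - L\<bar>)) \<partial>count_space UNIV) \<le> ennreal C2"
      using nn_integral_int_geometric[OF True] by auto
    show ?thesis
    proof (intro exI[of _ "D * C powr a * C1 * C2"] conjI allI impI)
      fix f :: "'a \<Rightarrow> real"
      assume f [measurable]: "f \<in> borel_measurable borel" and fC: "herz_norm s q r f \<le> ennreal C"
      have "(\<integral>\<^sup>+x. ennreal (exp (- norm x) * norm x powr \<gamma> * \<bar>f x\<bar> powr a) \<partial>lborel)
        = (\<integral>\<^sup>+k. (\<integral>\<^sup>+x. ennreal (exp (- norm x) * norm x powr \<gamma> * \<bar>f x\<bar> powr a) * indicator (annulus k) x \<partial>lborel) \<partial>count_space UNIV)"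
        by (rule nn_integral_annuli) measurable
      also have "\<dots> \<le> (\<integral>\<^sup>+k. ennreal (D * C powr a * C1) * ennreal (2 powr (- \<mu> * \<bar>real_of_int k - 0\<bar>)) \<partial>count_space UNIV)"
      proof (rule nn_integral_mono)
        fix k :: int
        have "D * C powr a * (2 powr (real_of_int k * \<mu>) * exp (- (2 powr (real_of_int k - 1))))
          \<le> D * C powr a * (C1 * 2 powr (- \<mu> * \<bar>real_of_int k - 0\<bar>))"
          using D by (intro mult_left_mono C1) auto
        then have "ennreal (D * C powr a * (2 powr (real_of_int k * \<mu>) * exp (- (2 powr (real_of_int k - 1)))))
          \<le> ennreal (D * C powr a * C1) * ennreal (2 powr (- \<mu> * \<bar>real_of_int k - 0\<bar>))"
          using D C1(1) by (subst ennreal_mult[symmetric]) (auto simp: mult.assoc intro!: ennreal_leI)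
        with piece[OF f herz_norm_annulus[OF fC C r] C, of k]
        show "(\<integral>\<^sup>+x. ennreal (exp (- norm x) * norm x powr \<gamma> * \<bar>f x\<bar> powr a) * indicator (annulus k) x \<partial>lborel)
          \<le> ennreal (D * C powr a * C1) * ennreal (2 powr (- \<mu> * \<bar>real_of_int k - 0\<bar>))"
          by (rule order_trans)
      qed
      also have "\<dots> = ennreal (D * C powr a * C1) * (\<integral>\<^sup>+k. ennreal (2 powr (- \<mu> * \<bar>real_of_int k - 0\<bar>)) \<partial>count_space UNIV)"
        by (rule nn_integral_cmult) simp
      also have "\<dots> \<le> ennreal (D * C powr a * C1) * ennreal C2"
        by (intro mult_left_mono C2) auto
      finally show "(\<integral>\<^sup>+x. ennreal (exp (- norm x) * norm x powr \<gamma> * \<bar>f x\<bar> powr a) \<partial>lborel)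
        \<le> ennreal (D * C powr a * C1 * C2)"
        using D C1(1) C2(1) by (simp add: ennreal_mult[symmetric])
    qed (use D C1 C2 in auto)
  next
    case False
    then have \<mu>0: "\<mu> = 0" "r \<le> ereal a" using \<mu> by auto
    show ?thesis
    proof (intro exI[of _ "D * C powr a"] conjI allI impI)
      fix f :: "'a \<Rightarrow> real"
      assume f [measurable]: "f \<in> borel_measurable borel" and fC: "herz_norm s q r f \<le> ennreal C"
      let ?a = "\<lambda>k. ennreal (2 powr (real_of_int k * s)) * Lq_norm q (\<lambda>x. f x * indicator (annulus k) x)"
      have "(\<integral>\<^sup>+x. ennreal (exp (- norm x) * norm x powr \<gamma> * \<bar>f x\<bar> powr a) \<partial>lborel)
        = (\<integral>\<^sup>+k. (\<integral>\<^sup>+x. ennreal (exp (- norm x) * norm x powr \<gamma> * \<bar>f x\<bar> powr a) * indicator (annulus k) x \<partial>lborel) \<partial>count_space UNIV)"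
        by (rule nn_integral_annuli) measurable
      also have "\<dots> \<le> (\<integral>\<^sup>+k. ennreal D * enn_powr (?a k) a \<partial>count_space UNIV)"
      proof (rule nn_integral_mono)
        fix k :: int
        show "(\<integral>\<^sup>+x. ennreal (exp (- norm x) * norm x powr \<gamma> * \<bar>f x\<bar> powr a) * indicator (annulus k) x \<partial>lborel)
          \<le> ennreal D * enn_powr (?a k) a"
        proof (cases "?a k")
          case (real c)
          have "D * c powr a * (2 powr (real_of_int k * \<mu>) * exp (- (2 powr (real_of_int k - 1)))) \<le> D * c powr a * 1"
            using D by (intro mult_left_mono) (auto simp: \<mu>0)
          then have "ennreal (D * c powr a * (2 powr (real_of_int k * \<mu>) * exp (- (2 powr (real_of_int k - 1)))))
            \<le> ennreal D * enn_powr (?a k) a"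
            using D real by (auto simp: enn_powr_ennreal ennreal_mult[symmetric] intro!: ennreal_leI)
          with piece[OF f _ real(1), of k] real(2) show ?thesis
            by (auto intro: order_trans)
        next
          case top
          then show ?thesis using herz_norm_annulus[OF fC C r, of k] by (simp add: top_unique)
        qed
      qed
      also have "\<dots> = ennreal D * (\<integral>\<^sup>+k. enn_powr (?a k) a \<partial>count_space UNIV)"
        by (rule nn_integral_cmult) simp
      also have "\<dots> \<le> ennreal D * ennreal (C powr a)"
        by (intro mult_left_mono herz_norm_summable[OF fC C r \<mu>0(2)]) auto
      finally show "(\<integral>\<^sup>+x. ennreal (exp (- norm x) * norm x powr \<gamma> * \<bar>f x\<bar> powr a) \<partial>lborel)
        \<le> ennreal (D * C powr a)"
        using D by (simp add: ennreal_mult[symmetric])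
    qed (use D in auto)
  qed
qed

subsection \<open>Gaussian bounds\<close>

text \<open>Annulus k contributes at most its volume times the value of the exponential at the inner
  radius, which \<open>annulus_exp_decay\<close> with \<mu> = n makes summable.\<close>

lemma exp_norm_integral_finite:
  "(\<integral>\<^sup>+x. ennreal (exp (- norm (x::'a::euclidean_space))) \<partial>lborel) < \<infinity>"
proof -
  let ?n = "real DIM('a)"
  have n: "?n > 0" by simp
  obtain C1 where C1: "C1 \<ge> 0" "\<And>k::int. 2 powr (real_of_int k * ?n) * exp (- (2 powr (real_of_int k - 1)))
    \<le> C1 * 2 powr (- ?n * \<bar>real_of_int k - 0\<bar>)" using annulus_exp_decay[OF n] by auto
  obtain C2 where C2: "\<And>L::real.
    (\<integral>\<^sup>+k. ennreal (2 powr (- ?n * \<bar>real_of_int k - L\<bar>)) \<partial>count_space UNIV) \<le> ennreal C2"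
    using nn_integral_int_geometric[OF n] by auto
  let ?v = "unit_ball_vol ?n"
  have "(\<integral>\<^sup>+x. ennreal (exp (- norm (x::'a))) \<partial>lborel)
    = (\<integral>\<^sup>+k. (\<integral>\<^sup>+x. ennreal (exp (- norm (x::'a))) * indicator (annulus k) x \<partial>lborel) \<partial>count_space UNIV)"
    by (rule nn_integral_annuli) measurable
  also have "\<dots> \<le> (\<integral>\<^sup>+k. ennreal (?v * C1) * ennreal (2 powr (- ?n * \<bar>real_of_int k - 0\<bar>)) \<partial>count_space UNIV)"
  proof (rule nn_integral_mono)
    fix k :: int
    let ?e = "exp (- (2 powr (real_of_int k - 1)))"
    have "(\<integral>\<^sup>+x. ennreal (exp (- norm (x::'a))) * indicator (annulus k) x \<partial>lborel)
      \<le> (\<integral>\<^sup>+x. ennreal ?e * indicator (annulus k :: 'a set) x \<partial>lborel)"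
      by (intro nn_integral_mono) (auto simp: indicator_def annulus_def)
    also have "\<dots> = ennreal ?e * emeasure lborel (annulus k :: 'a set)"
      by (rule nn_integral_cmult_indicator) simp
    also have "\<dots> \<le> ennreal ?e * ennreal (?v * 2 powr (real_of_int k * ?n))"
      by (intro mult_left_mono annulus_emeasure_le) auto
    also have "\<dots> = ennreal (?v * (2 powr (real_of_int k * ?n) * ?e))"
      by (simp add: ennreal_mult[symmetric] mult_ac)
    also have "\<dots> \<le> ennreal (?v * (C1 * 2 powr (- ?n * \<bar>real_of_int k - 0\<bar>)))"
      by (intro ennreal_leI mult_left_mono C1) auto
    also have "\<dots> = ennreal (?v * C1) * ennreal (2 powr (- ?n * \<bar>real_of_int k - 0\<bar>))"
      using C1(1) by (subst ennreal_mult[symmetric]) (auto simp: mult.assoc)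
    finally show "(\<integral>\<^sup>+x. ennreal (exp (- norm (x::'a))) * indicator (annulus k) x \<partial>lborel)
      \<le> ennreal (?v * C1) * ennreal (2 powr (- ?n * \<bar>real_of_int k - 0\<bar>))" .
  qed
  also have "\<dots> = ennreal (?v * C1) * (\<integral>\<^sup>+k. ennreal (2 powr (- ?n * \<bar>real_of_int k - 0\<bar>)) \<partial>count_space UNIV)"
    by (rule nn_integral_cmult) simp
  also have "\<dots> \<le> ennreal (?v * C1) * ennreal C2"
    by (intro mult_left_mono C2) auto
  also have "\<dots> < \<infinity>" by (simp add: ennreal_mult_less_top)
  finally show ?thesis .
qed

text \<open>Completing the square bounds the Gaussian by \<open>exp (1 / (4 * c))\<close> times the
  exponential integrated just before.\<close>

lemma gaussian_integral_finite:
  assumes "c > 0"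
  shows "(\<integral>\<^sup>+x. ennreal (exp (- c * (norm (x::'a::euclidean_space))\<^sup>2)) \<partial>lborel) < \<infinity>"
proof -
  have "(\<integral>\<^sup>+x. ennreal (exp (- c * (norm (x::'a))\<^sup>2)) \<partial>lborel)
    \<le> (\<integral>\<^sup>+x. ennreal (exp (1 / (4 * c))) * ennreal (exp (- norm (x::'a))) \<partial>lborel)"
  proof (rule nn_integral_mono)
    fix x :: 'a
    have "0 \<le> c * (norm x - 1 / (2 * c))\<^sup>2" using assms by simp
    also have "\<dots> = c * (norm x)\<^sup>2 - norm x + 1 / (4 * c)"
      using assms by (simp add: power2_eq_square field_simps)
    finally have "- c * (norm x)\<^sup>2 \<le> 1 / (4 * c) + - norm x" by simp
    then have "exp (- c * (norm x)\<^sup>2) \<le> exp (1 / (4 * c) + - norm x)" by simp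
    then show "ennreal (exp (- c * (norm x)\<^sup>2)) \<le> ennreal (exp (1 / (4 * c))) * ennreal (exp (- norm x))"
      by (simp only: exp_add ennreal_mult[symmetric] exp_ge_zero ennreal_leI)
  qed
  also have "\<dots> = ennreal (exp (1 / (4 * c))) * (\<integral>\<^sup>+x. ennreal (exp (- norm (x::'a))) \<partial>lborel)"
    by (rule nn_integral_cmult) simp
  also have "\<dots> < \<infinity>"
    using exp_norm_integral_finite[where ?'a = 'a] by (simp add: ennreal_mult_less_top)
  finally show ?thesis .
qed

text \<open>The heat kernel without its constant factor and with 8 t instead of 4 t in the exponent.
  The wider Gaussian leaves room to absorb an exponential factor.\<close>

definition gauss :: "real \<Rightarrow> 'a::euclidean_space \<Rightarrow> real" where
  "gauss t z = t powr (- real DIM('a) / 2) * exp (- (norm z)\<^sup>2 / (8 * t))"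

lemma gauss_nonneg: "gauss t z \<ge> 0"
  by (simp add: gauss_def)

lemma gauss_measurable [measurable]: "gauss t \<in> borel_measurable borel"
  unfolding gauss_def by measurable

text \<open>Parabolic scaling around y by \<open>sqrt t\<close> removes t from the integral: t^(n/2)
  comes from the Jacobian and t^(-n b/2) from the prefactor. Adding 1 to the remaining integral
  makes the constant positive.\<close>

lemma gauss_powr_integral:
  fixes b :: real
  assumes "b > 0"
  shows "\<exists>G>0. \<forall>t>0. \<forall>y::'a::euclidean_space.
    (\<integral>\<^sup>+x. ennreal (gauss t (x - y) powr b) \<partial>lborel) \<le> ennreal (G * t powr (real DIM('a) / 2 * (1 - b)))"
proof -
  define I where "I = (\<integral>\<^sup>+x. ennreal (exp (- (b / 8) * (norm (x::'a))\<^sup>2)) \<partial>lborel)"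
  have I: "I < \<infinity>" unfolding I_def using assms by (intro gaussian_integral_finite) auto
  show ?thesis
  proof (intro exI[of _ "enn2real I + 1"] conjI allI impI)
    fix t :: real and y :: 'a assume t: "t > 0"
    have "(\<integral>\<^sup>+x. ennreal (gauss t (x - y) powr b) \<partial>lborel)
      = (\<integral>\<^sup>+x. ennreal (gauss t (x - y) powr b)
          \<partial>density (distr lborel borel (\<lambda>x. y + sqrt t *\<^sub>R x)) (\<lambda>_. ennreal (\<bar>sqrt t\<bar> ^ DIM('a))))"
      using t by (subst lborel_affine[of "sqrt t" y]) auto
    also have "\<dots> = (\<integral>\<^sup>+x. ennreal (sqrt t ^ DIM('a)) * ennreal (gauss t (sqrt t *\<^sub>R x :: 'a) powr b) \<partial>lborel)"
      using t by (simp add: nn_integral_density nn_integral_distr)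
    also have "\<dots> = (\<integral>\<^sup>+x. ennreal (t powr (real DIM('a) / 2 * (1 - b))) * ennreal (exp (- (b / 8) * (norm (x::'a))\<^sup>2)) \<partial>lborel)"
    proof (intro nn_integral_cong)
      fix x :: 'a
      have "sqrt t ^ DIM('a) = t powr (real DIM('a) / 2)"
        using t by (simp add: powr_half_sqrt[symmetric] powr_realpow[symmetric] powr_powr)
      moreover have "gauss t (sqrt t *\<^sub>R x) powr b
        = t powr (- real DIM('a) / 2 * b) * exp (- (b / 8) * (norm x)\<^sup>2)"
        using t by (simp add: gauss_def powr_mult powr_powr power_mult_distrib exp_powr_real)
      moreover have "t powr (real DIM('a) / 2) * t powr (- real DIM('a) / 2 * b) = t powr (real DIM('a) / 2 * (1 - b))"
        by (simp add: powr_add[symmetric] algebra_simps diff_divide_distrib)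
      ultimately show "ennreal (sqrt t ^ DIM('a)) * ennreal (gauss t (sqrt t *\<^sub>R x) powr b)
        = ennreal (t powr (real DIM('a) / 2 * (1 - b))) * ennreal (exp (- (b / 8) * (norm x)\<^sup>2))"
        by (simp add: ennreal_mult[symmetric] mult.assoc[symmetric])
    qed
    also have "\<dots> = ennreal (t powr (real DIM('a) / 2 * (1 - b))) * I"
      unfolding I_def by (rule nn_integral_cmult) simp
    also have "\<dots> = ennreal (t powr (real DIM('a) / 2 * (1 - b)) * enn2real I)"
      using I by (simp add: ennreal_mult)
    also have "\<dots> \<le> ennreal ((enn2real I + 1) * t powr (real DIM('a) / 2 * (1 - b)))"
      by (intro ennreal_leI) (simp add: algebra_simps)
    finally show "(\<integral>\<^sup>+x. ennreal (gauss t (x - y) powr b) \<partial>lborel)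
      \<le> ennreal ((enn2real I + 1) * t powr (real DIM('a) / 2 * (1 - b)))" .
  qed (simp add: add_nonneg_pos)
qed

lemma le_powr_interpolate:
  fixes X P Q l :: real
  assumes "0 \<le> X" "X \<le> P" "X \<le> Q" "0 \<le> l" "l \<le> 1"
  shows "X \<le> P powr (1 - l) * Q powr l"
proof (cases "X = 0")
  case False
  then have "X = X powr (1 - l) * X powr l" using assms by (simp add: powr_add[symmetric])
  also have "\<dots> \<le> P powr (1 - l) * Q powr l"
    using assms by (intro mult_mono powr_mono2) auto
  finally show ?thesis .
qed simp

text \<open>Two bounds compete: the whole-space integral \<open>J1\<close>, free of k, and the
  supremum times the volume of the annulus, \<open>J2\<close>, which is more singular in t but gains
  a power of 2^k. Their geometric mean with weight l trades singularity in t for decay towards the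
  origin. The positive number J is exhibited because Hoelder is used with such a bound.\<close>

lemma gauss_annulus_integral:
  fixes \<kappa> l :: real
  assumes \<kappa>: "0 \<le> \<kappa>" "\<kappa> < 1" and l: "0 \<le> l" "l \<le> 1"
  shows "\<exists>C\<ge>0. \<forall>t>0. \<forall>y::'a::euclidean_space. \<forall>k::int. \<exists>J>0.
    (\<integral>\<^sup>+x. ennreal (gauss t (x - y) powr (1 / (1 - \<kappa>))) * indicator (annulus k) x \<partial>lborel) \<le> ennreal J \<and>
    J powr (1 - \<kappa>) \<le> C * t powr (- (real DIM('a) / 2 * (\<kappa> + l * (1 - \<kappa>))))
        * 2 powr (real_of_int k * (real DIM('a) * (1 - \<kappa>) * l))"
proof -
  let ?n = "real DIM('a)"
  define b where "b = 1 / (1 - \<kappa>)"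
  have b: "b > 0" "b * (1 - \<kappa>) = 1" using \<kappa> by (auto simp: b_def)
  obtain G where G: "G > 0" "\<And>t (y::'a). t > 0 \<Longrightarrow>
    (\<integral>\<^sup>+x. ennreal (gauss t (x - y) powr b) \<partial>lborel) \<le> ennreal (G * t powr (?n / 2 * (1 - b)))"
    using gauss_powr_integral[OF b(1), where ?'a = 'a] by auto
  define v where "v = unit_ball_vol ?n"
  have v: "v > 0" by (simp add: v_def)
  define G' where "G' = G powr (1 - \<kappa>)"
  define v' where "v' = v powr (1 - \<kappa>)"
  show ?thesis
  proof (rule exI[of _ "G' powr (1 - l) * v' powr l"], intro conjI allI impI)
    fix t :: real and y :: 'a and k :: int
    assume t: "t > 0"
    define J1 where "J1 = G * t powr (?n / 2 * (1 - b))"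
    define J2 where "J2 = t powr (- ?n / 2 * b) * (v * 2 powr (real_of_int k * ?n))"
    have J12: "J1 > 0" "J2 > 0" using G v t by (auto simp: J1_def J2_def)
    have 1: "(\<integral>\<^sup>+x. ennreal (gauss t (x - y) powr b) * indicator (annulus k) x \<partial>lborel) \<le> ennreal J1"
      unfolding J1_def
      by (rule order_trans[OF nn_integral_mono G(2)[OF t]]) (auto simp: indicator_def)
    have "(\<integral>\<^sup>+x. ennreal (gauss t (x - y) powr b) * indicator (annulus k) x \<partial>lborel)
      \<le> (\<integral>\<^sup>+x. ennreal (t powr (- ?n / 2 * b)) * indicator (annulus k :: 'a set) x \<partial>lborel)"
    proof (intro nn_integral_mono mult_right_mono ennreal_leI)
      fix x :: 'a
      have "gauss t (x - y) \<le> t powr (- ?n / 2)"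
        unfolding gauss_def using t by (intro mult_left_le) auto
      then have "gauss t (x - y) powr b \<le> (t powr (- ?n / 2)) powr b"
        using b by (intro powr_mono2 gauss_nonneg) auto
      then show "gauss t (x - y) powr b \<le> t powr (- ?n / 2 * b)" by (simp add: powr_powr)
    qed simp
    also have "\<dots> = ennreal (t powr (- ?n / 2 * b)) * emeasure lborel (annulus k :: 'a set)"
      by (rule nn_integral_cmult_indicator) simp
    also have "\<dots> \<le> ennreal (t powr (- ?n / 2 * b)) * ennreal (v * 2 powr (real_of_int k * ?n))"
      unfolding v_def by (intro mult_left_mono annulus_emeasure_le) auto
    also have "\<dots> = ennreal J2" using v by (simp add: J2_def ennreal_mult)
    finally have 2: "(\<integral>\<^sup>+x. ennreal (gauss t (x - y) powr b) * indicator (annulus k) x \<partial>lborel) \<le> ennreal J2" .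
    define J where "J = min J1 J2"
    have J: "J > 0" using J12 by (simp add: J_def)
    have P: "J powr (1 - \<kappa>) \<le> G' * t powr (- (?n / 2) * \<kappa>)"
    proof -
      have "?n / 2 * (1 - b) * (1 - \<kappa>) = - (?n / 2) * \<kappa>"
        using b by algebra
      then have "J1 powr (1 - \<kappa>) = G' * t powr (- (?n / 2) * \<kappa>)"
        using G by (simp add: J1_def G'_def powr_mult powr_powr)
      moreover have "J powr (1 - \<kappa>) \<le> J1 powr (1 - \<kappa>)"
        using J \<kappa> by (intro powr_mono2) (auto simp: J_def)
      ultimately show ?thesis by simp
    qed
    have Q: "J powr (1 - \<kappa>) \<le> v' * (t powr (- (?n / 2)) * 2 powr (real_of_int k * (?n * (1 - \<kappa>))))"
    proof -
      have "- ?n / 2 * b * (1 - \<kappa>) = - (?n / 2)"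
        using b by algebra
      then have "(t powr (- ?n / 2 * b)) powr (1 - \<kappa>) = t powr (- (?n / 2))"
        by (simp only: powr_powr)
      moreover have "(2 powr (real_of_int k * ?n)) powr (1 - \<kappa>) = 2 powr (real_of_int k * (?n * (1 - \<kappa>)))"
        by (simp only: powr_powr mult.assoc)
      ultimately have "J2 powr (1 - \<kappa>) = v' * (t powr (- (?n / 2)) * 2 powr (real_of_int k * (?n * (1 - \<kappa>))))"
        using v by (simp add: J2_def v'_def powr_mult)
      moreover have "J powr (1 - \<kappa>) \<le> J2 powr (1 - \<kappa>)"
        using J \<kappa> by (intro powr_mono2) (auto simp: J_def)
      ultimately show ?thesis by simp
    qed
    have "J powr (1 - \<kappa>) \<le> (G' * t powr (- (?n / 2) * \<kappa>)) powr (1 - l)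
        * (v' * (t powr (- (?n / 2)) * 2 powr (real_of_int k * (?n * (1 - \<kappa>))))) powr l"
      using P Q l by (intro le_powr_interpolate) auto
    also have "\<dots> = G' powr (1 - l) * v' powr l * (t powr (- (?n / 2) * \<kappa> * (1 - l)) * t powr (- (?n / 2) * l))
        * 2 powr (real_of_int k * (?n * (1 - \<kappa>) * l))"
      by (simp add: powr_mult powr_powr G'_def v'_def mult_ac)
    also have "t powr (- (?n / 2) * \<kappa> * (1 - l)) * t powr (- (?n / 2) * l) = t powr (- (?n / 2 * (\<kappa> + l * (1 - \<kappa>))))"
      unfolding powr_add[symmetric] by (rule arg_cong[where f = "(powr) t"]) algebra
    finally have fin: "J powr (1 - \<kappa>) \<le> G' powr (1 - l) * v' powr l * t powr (- (?n / 2 * (\<kappa> + l * (1 - \<kappa>))))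
        * 2 powr (real_of_int k * (?n * (1 - \<kappa>) * l))" .
    show "\<exists>J>0.
      (\<integral>\<^sup>+x. ennreal (gauss t (x - y) powr (1 / (1 - \<kappa>))) * indicator (annulus k) x \<partial>lborel) \<le> ennreal J \<and>
      J powr (1 - \<kappa>) \<le> G' powr (1 - l) * v' powr l * t powr (- (?n / 2 * (\<kappa> + l * (1 - \<kappa>))))
        * 2 powr (real_of_int k * (?n * (1 - \<kappa>) * l))"
      using fin J 1 2 by (intro exI[of _ J] conjI) (auto simp: b_def[symmetric] J_def min_def)
  qed simp
qed

section \<open>The heat kernel under exponential weights\<close>

lemma heat_kernel_nonneg: "heat_kernel t z \<ge> 0"
  by (simp add: heat_kernel_def)

lemma heat_kernel_measurable [measurable (raw)]:
  fixes g :: "'b \<Rightarrow> 'a::euclidean_space"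
  assumes [measurable]: "f \<in> borel_measurable N" "g \<in> borel_measurable N"
  shows "(\<lambda>z. heat_kernel (f z) (g z)) \<in> borel_measurable N"
  unfolding heat_kernel_def by measurable

text \<open>Half of the Gaussian exponent absorbs the exponential: completing the square gives 2 |z|
  - |z|^2 / (8 t) \<le> 8 t \<le> 8 T. The other half remains in \<open>gauss\<close>.\<close>

lemma heat_kernel_exp_le_gauss:
  fixes z :: "'a::euclidean_space"
  assumes "0 < t" "t \<le> T"
  shows "exp (2 * norm z) * heat_kernel t z \<le> exp (8 * T) * (4 * pi) powr (- real DIM('a) / 2) * gauss t z"
proof -
  have "0 \<le> (norm z - 8 * t)\<^sup>2 / (8 * t)" using assms by simp
  also have "\<dots> = (norm z)\<^sup>2 / (8 * t) - 2 * norm z + 8 * t"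
    using assms by (simp add: power2_eq_square field_simps)
  finally have *: "0 \<le> (norm z)\<^sup>2 / (8 * t) - 2 * norm z + 8 * t" .
  have "2 * norm z - (norm z)\<^sup>2 / (4 * t) \<le> 8 * T - (norm z)\<^sup>2 / (8 * t)"
  proof -
    have "(norm z)\<^sup>2 / (4 * t) = 2 * ((norm z)\<^sup>2 / (8 * t))" by simp
    then show ?thesis using * assms by linarith
  qed
  then have "exp (2 * norm z) * exp (- (norm z)\<^sup>2 / (4 * t)) \<le> exp (8 * T) * exp (- (norm z)\<^sup>2 / (8 * t))"
    by (simp add: exp_add[symmetric])
  then have "(4 * pi * t) powr (- real DIM('a) / 2) * (exp (2 * norm z) * exp (- (norm z)\<^sup>2 / (4 * t)))
    \<le> (4 * pi * t) powr (- real DIM('a) / 2) * (exp (8 * T) * exp (- (norm z)\<^sup>2 / (8 * t)))"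
    by (rule mult_left_mono) simp
  then show ?thesis
    using assms by (simp add: heat_kernel_def gauss_def powr_mult mult_ac)
qed

text \<open>The logarithm is 1-Lipschitz on [1, \<infinity>), so radial distance dominates ln 2
  times the distance of dyadic scales. As k > 0 forces norm x \<ge> 1, truncating norm y at 1 does
  not increase the radial distance. The leading 2 pays for ln (norm x) differing from k ln 2 by up
  to ln 2.\<close>

lemma exp_radial_distance_le:
  fixes x y :: "'a::euclidean_space"
  assumes "x \<in> annulus k" "k > 0"
  shows "exp (- \<bar>norm x - norm y\<bar>) \<le> 2 * 2 powr (- 1 * \<bar>real_of_int k - log 2 (max 1 (norm y))\<bar>)"
proof -
  have lip: "\<bar>ln a - ln b\<bar> \<le> \<bar>a - b\<bar>" if "a \<ge> 1" "b \<ge> 1" for a b :: real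
  proof -
    have "ln u - ln w \<le> u - w" if "u \<ge> w" "w \<ge> 1" for u w :: real
    proof -
      have "ln (u / w) \<le> u / w - 1" using that by (intro ln_le_minus_one) auto
      also have "\<dots> = (u - w) / w" using that by (simp add: field_simps)
      also have "\<dots> \<le> u - w" using that by (simp add: divide_le_eq mult_le_cancel_left1)
      finally show ?thesis using that by (simp add: ln_div)
    qed
    from this[of b a] this[of a b] that show ?thesis
      by (cases "a \<le> b") (auto simp: abs_if)
  qed
  have x1: "norm x \<ge> 1"
  proof -
    have "1 \<le> 2 powr (real_of_int k - 1)" using assms by (intro ge_one_powr_ge_zero) auto
    then show ?thesis using assms by (auto simp: annulus_def)
  qed
  let ?Y = "max 1 (norm y)"
  have "\<bar>ln (norm x) - ln ?Y\<bar> \<le> \<bar>norm x - ?Y\<bar>"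
    using x1 by (intro lip) auto
  also have "\<dots> \<le> \<bar>norm x - norm y\<bar>" using x1 by auto
  finally have 1: "\<bar>ln (norm x) - ln ?Y\<bar> \<le> \<bar>norm x - norm y\<bar>" .
  have "(real_of_int k - 1) * ln 2 \<le> ln (norm x)" "ln (norm x) \<le> real_of_int k * ln 2"
  proof -
    have "ln (2 powr (real_of_int k - 1)) \<le> ln (norm x)" "ln (norm x) \<le> ln (2 powr real_of_int k)"
      using assms x1 by (auto simp: annulus_def simp del: ln_powr intro!: ln_mono)
    then show "(real_of_int k - 1) * ln 2 \<le> ln (norm x)" "ln (norm x) \<le> real_of_int k * ln 2"
      by simp_all
  qed
  then have "\<bar>real_of_int k * ln 2 - ln (norm x)\<bar> \<le> ln 2" by (simp add: algebra_simps)
  with 1 have "\<bar>real_of_int k * ln 2 - ln ?Y\<bar> \<le> \<bar>norm x - norm y\<bar> + ln 2" by linarith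
  moreover have "\<bar>real_of_int k * ln 2 - ln ?Y\<bar> = \<bar>real_of_int k - log 2 ?Y\<bar> * ln 2"
  proof -
    have "real_of_int k * ln 2 - ln ?Y = (real_of_int k - log 2 ?Y) * ln 2"
      by (simp add: log_def algebra_simps)
    then show ?thesis by (simp add: abs_mult)
  qed
  ultimately have "- \<bar>norm x - norm y\<bar> \<le> ln 2 + (- 1 * \<bar>real_of_int k - log 2 ?Y\<bar>) * ln 2" by simp
  then have "exp (- \<bar>norm x - norm y\<bar>) \<le> exp (ln 2 + (- 1 * \<bar>real_of_int k - log 2 ?Y\<bar>) * ln 2)" by simp
  also have "\<dots> = 2 * 2 powr (- 1 * \<bar>real_of_int k - log 2 ?Y\<bar>)"
    by (simp only: exp_add powr_def) simp
  finally show ?thesis .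
qed

text \<open>The potential \<open>|x|\<^sup>\<gamma>|u|\<^sup>\<alpha>\<^sup>-\<^sup>1\<close> satisfies a Kato-type condition. On the annuli outside the
  unit ball the weight exponent \<open>a s - \<gamma>\<close> has the good sign, and the factor \<open>exp (norm y - norm x)\<close>, paid
  for by the Gaussian, makes the sum over the annuli uniform in \<open>y\<close>; inside the unit ball the slack
  in the exponent condition makes it a geometric series.\<close>

lemma herz_kato_bound:
  fixes s \<gamma> a C T :: real and q r :: ereal
  defines "\<kappa> \<equiv> a * real_of_ereal (1 / q)"
  assumes a: "a > 0" "ereal a < q" and r: "r > 0" and C: "C \<ge> 0" and T: "T > 0"
    and \<sigma>: "a * s \<ge> \<gamma>"
    and A: "\<kappa> + (a * s - \<gamma>) / real DIM('a) < min 1 (2 / real DIM('a))"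
  shows "\<exists>K\<ge>0. \<exists>\<theta><1. \<forall>f::'a::euclidean_space \<Rightarrow> real. f \<in> borel_measurable borel \<longrightarrow>
    herz_norm s q r f \<le> ennreal C \<longrightarrow> (\<forall>t y. 0 < t \<longrightarrow> t \<le> T \<longrightarrow>
    (\<integral>\<^sup>+x. ennreal (exp (norm y - norm x) * norm x powr \<gamma> * \<bar>f x\<bar> powr a * heat_kernel t (x - y)) \<partial>lborel)
      \<le> ennreal (K * t powr (- \<theta>)))"
proof -
  let ?n = "real DIM('a)"
  define \<sigma> where "\<sigma> = a * s - \<gamma>"
  have \<sigma>0: "\<sigma> \<ge> 0" using \<sigma> by (simp add: \<sigma>_def)
  have \<kappa>: "0 \<le> \<kappa>" "\<kappa> < 1"
  proof -
    show "0 \<le> \<kappa>" using a by (cases q) (auto simp: \<kappa>_def one_ereal_def)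
    have "0 \<le> (a * s - \<gamma>) / ?n" using \<sigma> by simp
    then show "\<kappa> < 1" using A by linarith
  qed
  \<comment> \<open>A number \<rho> is inserted into the slack of the exponent condition, and l is
    fixed by \<kappa> + l (1 - \<kappa>) = \<rho>. Then \<rho> < 1 gives l \<le> 1, \<rho> < 2 / n
    gives \<theta> < 1, and \<kappa> + \<sigma> / n < \<rho> gives the surplus \<eta> > 0.\<close>
  have "\<kappa> + \<sigma> / ?n < min 1 (2 / ?n)" using A by (simp only: \<sigma>_def)
  then obtain \<rho> where \<rho>: "\<kappa> + \<sigma> / ?n < \<rho>" "\<rho> < 1" "\<rho> < 2 / ?n"
    by (meson dense min_less_iff_conj)
  define l where "l = (\<rho> - \<kappa>) / (1 - \<kappa>)"
  have "0 \<le> \<sigma> / ?n" using \<sigma>0 by simp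
  then have l: "0 \<le> l" "l \<le> 1" "l * (1 - \<kappa>) = \<rho> - \<kappa>"
    using \<rho> \<kappa> by (auto simp: l_def)
  define \<theta> where "\<theta> = ?n / 2 * \<rho>"
  have \<theta>: "\<theta> < 1" using \<rho> by (simp add: \<theta>_def field_simps)
  define \<eta> where "\<eta> = ?n * (1 - \<kappa>) * l - \<sigma>"
  have \<eta>: "\<eta> > 0"
  proof -
    have "\<sigma> = ?n * (\<sigma> / ?n)" by simp
    also have "\<dots> < ?n * (\<rho> - \<kappa>)" using \<rho> by (intro mult_strict_left_mono) auto
    finally show ?thesis unfolding \<eta>_def l(3)[symmetric] by (simp add: mult_ac)
  qed
  obtain C1 where C1: "C1 \<ge> 0" "\<And>t (y::'a) k. t > 0 \<Longrightarrow> \<exists>J>0.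
    (\<integral>\<^sup>+x. ennreal (gauss t (x - y) powr (1 / (1 - \<kappa>))) * indicator (annulus k) x \<partial>lborel) \<le> ennreal J \<and>
    J powr (1 - \<kappa>) \<le> C1 * t powr (- \<theta>) * 2 powr (real_of_int k * (?n * (1 - \<kappa>) * l))"
    using gauss_annulus_integral[OF \<kappa> l(1,2), where ?'a = 'a] l(3) by (auto simp: \<theta>_def)
  \<comment> \<open>Weight l = 0 serves the annuli outside the unit ball, where a positive power of
    2^k would be a loss.\<close>
  obtain C2 where C2: "C2 \<ge> 0" "\<And>t (y::'a) k. t > 0 \<Longrightarrow> \<exists>J>0.
    (\<integral>\<^sup>+x. ennreal (gauss t (x - y) powr (1 / (1 - \<kappa>))) * indicator (annulus k) x \<partial>lborel) \<le> ennreal J \<and>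
    J powr (1 - \<kappa>) \<le> C2 * t powr (- (?n / 2 * \<kappa>))"
    using gauss_annulus_integral[OF \<kappa>, of 0, where ?'a = 'a] by auto
  obtain Z1 where Z1: "Z1 \<ge> 0" "\<And>L::real.
    (\<integral>\<^sup>+k. ennreal (2 powr (- \<eta> * \<bar>real_of_int k - L\<bar>)) \<partial>count_space UNIV) \<le> ennreal Z1"
    using nn_integral_int_geometric[OF \<eta>] by auto
  obtain Z2 where Z2: "Z2 \<ge> 0" "\<And>L::real.
    (\<integral>\<^sup>+k. ennreal (2 powr (- 1 * \<bar>real_of_int k - L\<bar>)) \<partial>count_space UNIV) \<le> ennreal Z2"
    using nn_integral_int_geometric[of 1] by auto
  define E where "E = exp (8 * T) * (4 * pi) powr (- ?n / 2) * 2 powr \<bar>\<gamma>\<bar> * C powr a"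
  have E: "E \<ge> 0" by (simp add: E_def)
  define M1 where "M1 = E * C1"
  \<comment> \<open>The power of T converts the milder singularity t^(-n \<kappa>/2) of the outer
    annuli into t^(-\<theta>), using n \<kappa>/2 \<le> \<theta> and t \<le> T.\<close>
  define M2 where "M2 = E * 2 * C2 * T powr (\<theta> - ?n / 2 * \<kappa>)"
  have M: "M1 \<ge> 0" "M2 \<ge> 0" using E C1 C2 by (auto simp: M1_def M2_def)
  show ?thesis
  proof (rule exI[of _ "M1 * Z1 + M2 * Z2"], intro exI[of _ \<theta>] conjI allI impI)
    fix f :: "'a \<Rightarrow> real" and t :: real and y :: 'a
    assume f [measurable]: "f \<in> borel_measurable borel" and fC: "herz_norm s q r f \<le> ennreal C"
      and t: "0 < t" "t \<le> T"
    let ?g = "\<lambda>x. exp (norm y - norm x) * norm x powr \<gamma> * \<bar>f x\<bar> powr a * heat_kernel t (x - y)"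
    \<comment> \<open>Here e bounds the radial decay factor and X the Gaussian factor; both are
      chosen differently inside and outside the unit ball.\<close>
    have piece: "(\<integral>\<^sup>+x. ennreal (?g x) * indicator (annulus k) x \<partial>lborel) \<le> ennreal (E * e * 2 powr (- real_of_int k * \<sigma>) * X)"
      if e: "e \<ge> 0" "\<And>x::'a. x \<in> annulus k \<Longrightarrow> exp (- \<bar>norm x - norm y\<bar>) \<le> e"
        and J: "J > 0" "(\<integral>\<^sup>+x. ennreal (gauss t (x - y) powr (1 / (1 - \<kappa>))) * indicator (annulus k) x \<partial>lborel) \<le> ennreal J"
          "J powr (1 - \<kappa>) \<le> X"
      for k e J X
    proof -
      let ?w = "exp (8 * T) * (4 * pi) powr (- ?n / 2) * e * (2 powr \<bar>\<gamma>\<bar> * 2 powr (real_of_int k * \<gamma>))"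
      have "(\<integral>\<^sup>+x. ennreal (?g x) * indicator (annulus k) x \<partial>lborel)
        \<le> (\<integral>\<^sup>+x. ennreal ?w * (ennreal (\<bar>f x\<bar> powr a * gauss t (x - y)) * indicator (annulus k) x) \<partial>lborel)"
      proof (rule nn_integral_mono)
        fix x :: 'a
        show "ennreal (?g x) * indicator (annulus k) x
          \<le> ennreal ?w * (ennreal (\<bar>f x\<bar> powr a * gauss t (x - y)) * indicator (annulus k) x)"
        proof (cases "x \<in> annulus k")
          case True
          \<comment> \<open>Both norm y - norm x and the radial distance are at most |x - y|.
            Spending 2 |x - y|, which the heat kernel can afford, thus leaves a genuine decay in the
            radial distance.\<close>
          have "norm y - norm x \<le> 2 * norm (x - y) - \<bar>norm x - norm y\<bar>"
            using norm_triangle_ineq2[of x y] norm_triangle_ineq2[of y x] by (simp add: norm_minus_commute)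
          then have "exp (norm y - norm x) \<le> exp (- \<bar>norm x - norm y\<bar>) * exp (2 * norm (x - y))"
            by (simp add: exp_add[symmetric])
          then have "exp (norm y - norm x) * heat_kernel t (x - y)
            \<le> exp (- \<bar>norm x - norm y\<bar>) * exp (2 * norm (x - y)) * heat_kernel t (x - y)"
            by (intro mult_right_mono heat_kernel_nonneg)
          also have "\<dots> \<le> e * (exp (8 * T) * (4 * pi) powr (- ?n / 2) * gauss t (x - y))"
            unfolding mult.assoc[of "exp (- \<bar>norm x - norm y\<bar>)"]
            by (intro mult_mono[OF e(2)[OF True] heat_kernel_exp_le_gauss[OF t]] mult_nonneg_nonneg
              heat_kernel_nonneg e(1)) auto
          finally have le: "exp (norm y - norm x) * heat_kernel t (x - y)
            \<le> e * (exp (8 * T) * (4 * pi) powr (- ?n / 2) * gauss t (x - y))" .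
          have "exp (norm y - norm x) * heat_kernel t (x - y) * (norm x powr \<gamma> * \<bar>f x\<bar> powr a)
            \<le> e * (exp (8 * T) * (4 * pi) powr (- ?n / 2) * gauss t (x - y))
              * (2 powr \<bar>\<gamma>\<bar> * 2 powr (real_of_int k * \<gamma>) * \<bar>f x\<bar> powr a)"
            using e(1) by (intro mult_mono[OF le mult_right_mono[OF norm_powr_annulus_le[OF True]]] mult_nonneg_nonneg gauss_nonneg) auto
          then have "?g x \<le> ?w * (\<bar>f x\<bar> powr a * gauss t (x - y))"
            by (simp add: mult_ac)
          then have "ennreal (?g x) \<le> ennreal ?w * ennreal (\<bar>f x\<bar> powr a * gauss t (x - y))"
            using e by (subst ennreal_mult[symmetric]) (auto intro!: ennreal_leI gauss_nonneg mult_nonneg_nonneg)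
          then show ?thesis using True by simp
        qed simp
      qed
      also have "\<dots> = ennreal ?w * (\<integral>\<^sup>+x. ennreal (\<bar>f x\<bar> powr a * gauss t (x - y)) * indicator (annulus k) x \<partial>lborel)"
        by (rule nn_integral_cmult) simp
      also have "\<dots> \<le> ennreal ?w * ennreal ((C * 2 powr (- real_of_int k * s)) powr a * J powr (1 - a * real_of_ereal (1 / q)))"
        using a C J Lq_norm_of_scaled_le[OF herz_norm_annulus[OF fC C r] C]
        by (intro mult_left_mono Lq_Holder) (auto simp: \<kappa>_def gauss_nonneg)
      also have "\<dots> = ennreal (?w * ((C * 2 powr (- real_of_int k * s)) powr a * J powr (1 - \<kappa>)))"
        using e by (simp add: ennreal_mult[symmetric] \<kappa>_def)
      also have "\<dots> = ennreal (E * e * 2 powr (- real_of_int k * \<sigma>) * J powr (1 - \<kappa>))"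
      proof -
        have eq: "2 powr (real_of_int k * \<gamma>) * (2 powr (- real_of_int k * s)) powr a = 2 powr (- real_of_int k * \<sigma>)"
          by (simp add: powr_powr powr_add[symmetric] \<sigma>_def algebra_simps)
        show ?thesis using C unfolding eq[symmetric] E_def by (simp add: powr_mult mult_ac)
      qed
      also have "\<dots> \<le> ennreal (E * e * 2 powr (- real_of_int k * \<sigma>) * X)"
        using E e J by (intro ennreal_leI mult_left_mono) auto
      finally show ?thesis .
    qed
    let ?L = "log 2 (max 1 (norm y))"
    have "(\<integral>\<^sup>+x. ennreal (?g x) \<partial>lborel)
      = (\<integral>\<^sup>+k. (\<integral>\<^sup>+x. ennreal (?g x) * indicator (annulus k) x \<partial>lborel) \<partial>count_space UNIV)"
      by (rule nn_integral_annuli) measurable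
    also have "\<dots> \<le> (\<integral>\<^sup>+k. ennreal (M1 * t powr (- \<theta>)) * ennreal (2 powr (- \<eta> * \<bar>real_of_int k - 0\<bar>))
      + ennreal (M2 * t powr (- \<theta>)) * ennreal (2 powr (- 1 * \<bar>real_of_int k - ?L\<bar>)) \<partial>count_space UNIV)"
    proof (rule nn_integral_mono)
      fix k :: int
      show "(\<integral>\<^sup>+x. ennreal (?g x) * indicator (annulus k) x \<partial>lborel)
        \<le> ennreal (M1 * t powr (- \<theta>)) * ennreal (2 powr (- \<eta> * \<bar>real_of_int k - 0\<bar>))
      + ennreal (M2 * t powr (- \<theta>)) * ennreal (2 powr (- 1 * \<bar>real_of_int k - ?L\<bar>))"
      proof (cases "k > 0")
        case False
        \<comment> \<open>For k \<le> 0 the trivial decay bound e = 1 suffices: since |k| = -k, the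
          powers of 2 combine to the geometric term with rate \<eta>.\<close>
        obtain J where J: "J > 0"
          "(\<integral>\<^sup>+x. ennreal (gauss t (x - y) powr (1 / (1 - \<kappa>))) * indicator (annulus k) x \<partial>lborel) \<le> ennreal J"
          "J powr (1 - \<kappa>) \<le> C1 * t powr (- \<theta>) * 2 powr (real_of_int k * (?n * (1 - \<kappa>) * l))"
          using C1(2)[OF t(1), where y = y and k = k] by auto
        have "2 powr (- real_of_int k * \<sigma>) * 2 powr (real_of_int k * (?n * (1 - \<kappa>) * l)) = 2 powr (- \<eta> * \<bar>real_of_int k - 0\<bar>)"
          using False by (simp add: powr_add[symmetric] \<eta>_def algebra_simps)
        then have eq: "E * 1 * 2 powr (- real_of_int k * \<sigma>) * (C1 * t powr (- \<theta>) * 2 powr (real_of_int k * (?n * (1 - \<kappa>) * l)))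
          = M1 * t powr (- \<theta>) * 2 powr (- \<eta> * \<bar>real_of_int k - 0\<bar>)"
          by (simp add: M1_def mult_ac)
        have "(\<integral>\<^sup>+x. ennreal (?g x) * indicator (annulus k) x \<partial>lborel)
          \<le> ennreal (M1 * t powr (- \<theta>) * 2 powr (- \<eta> * \<bar>real_of_int k - 0\<bar>))"
          unfolding eq[symmetric] by (rule piece[OF _ _ J]) auto
        also have "\<dots> = ennreal (M1 * t powr (- \<theta>)) * ennreal (2 powr (- \<eta> * \<bar>real_of_int k - 0\<bar>))"
          using M by (intro ennreal_mult) auto
        finally show ?thesis by (rule order_trans) simp
      next
        case True
        obtain J where J: "J > 0"
          "(\<integral>\<^sup>+x. ennreal (gauss t (x - y) powr (1 / (1 - \<kappa>))) * indicator (annulus k) x \<partial>lborel) \<le> ennreal J"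
          "J powr (1 - \<kappa>) \<le> C2 * t powr (- (?n / 2 * \<kappa>))"
          using C2(2)[OF t(1), where y = y and k = k] by auto
        let ?e = "2 * 2 powr (- 1 * \<bar>real_of_int k - ?L\<bar>)"
        \<comment> \<open>Since \<sigma> \<ge> 0 and k > 0, the Herz and power weights together
          contribute a factor at most 1, and summability rests on the radial decay centred at
          \<open>?L\<close>.\<close>
        have le: "E * ?e * 2 powr (- real_of_int k * \<sigma>) * (C2 * t powr (- (?n / 2 * \<kappa>)))
          \<le> M2 * t powr (- \<theta>) * 2 powr (- 1 * \<bar>real_of_int k - ?L\<bar>)"
        proof -
          have "t powr (- (?n / 2 * \<kappa>)) = t powr (- \<theta>) * t powr (\<theta> - ?n / 2 * \<kappa>)"
            by (simp add: powr_add[symmetric])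
          also have "\<dots> \<le> t powr (- \<theta>) * T powr (\<theta> - ?n / 2 * \<kappa>)"
          proof (intro mult_left_mono powr_mono2)
            have "\<kappa> \<le> \<rho>" using \<rho> \<open>0 \<le> \<sigma> / ?n\<close> by linarith
            then have "?n / 2 * \<kappa> \<le> \<theta>" unfolding \<theta>_def by (intro mult_left_mono) auto
            then show "0 \<le> \<theta> - ?n / 2 * \<kappa>" by simp
          qed (use t in auto)
          finally have "2 powr (- real_of_int k * \<sigma>) * t powr (- (?n / 2 * \<kappa>)) \<le> 1 * (t powr (- \<theta>) * T powr (\<theta> - ?n / 2 * \<kappa>))"
            using powr_mono[of "- real_of_int k * \<sigma>" 0 2] True \<sigma>0 by (intro mult_mono) (auto intro!: mult_nonneg_nonneg)
          then have "E * ?e * C2 * (2 powr (- real_of_int k * \<sigma>) * t powr (- (?n / 2 * \<kappa>)))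
            \<le> E * ?e * C2 * (1 * (t powr (- \<theta>) * T powr (\<theta> - ?n / 2 * \<kappa>)))"
            using E C2 by (intro mult_left_mono) auto
          then show ?thesis by (simp add: M2_def mult_ac)
        qed
        have "(\<integral>\<^sup>+x. ennreal (?g x) * indicator (annulus k) x \<partial>lborel)
          \<le> ennreal (E * ?e * 2 powr (- real_of_int k * \<sigma>) * (C2 * t powr (- (?n / 2 * \<kappa>))))"
          using exp_radial_distance_le[OF _ True] by (intro piece[OF _ _ J]) auto
        also have "\<dots> \<le> ennreal (M2 * t powr (- \<theta>) * 2 powr (- 1 * \<bar>real_of_int k - ?L\<bar>))"
          by (rule ennreal_leI[OF le])
        also have "\<dots> = ennreal (M2 * t powr (- \<theta>)) * ennreal (2 powr (- 1 * \<bar>real_of_int k - ?L\<bar>))"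
          using M by (intro ennreal_mult) auto
        finally show ?thesis by (rule order_trans) simp
      qed
    qed
    also have "\<dots> = ennreal (M1 * t powr (- \<theta>)) * (\<integral>\<^sup>+k. ennreal (2 powr (- \<eta> * \<bar>real_of_int k - 0\<bar>)) \<partial>count_space UNIV)
      + ennreal (M2 * t powr (- \<theta>)) * (\<integral>\<^sup>+k. ennreal (2 powr (- 1 * \<bar>real_of_int k - ?L\<bar>)) \<partial>count_space UNIV)"
      by (subst nn_integral_add) (auto simp: nn_integral_cmult)
    also have "\<dots> \<le> ennreal (M1 * t powr (- \<theta>)) * ennreal Z1 + ennreal (M2 * t powr (- \<theta>)) * ennreal Z2"
      by (intro add_mono mult_left_mono Z1 Z2) auto
    also have "\<dots> = ennreal ((M1 * Z1 + M2 * Z2) * t powr (- \<theta>))"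
      using M Z1(1) Z2(1) by (simp add: ennreal_mult[symmetric] ennreal_plus[symmetric] algebra_simps del: ennreal_plus)
    finally show "(\<integral>\<^sup>+x. ennreal (?g x) \<partial>lborel) \<le> ennreal ((M1 * Z1 + M2 * Z2) * t powr (- \<theta>))" .
  qed (use M Z1 Z2 \<theta> in auto)
qed

subsection \<open>A singular Gronwall inequality\<close>

lemma exp_minus_le_powr_minus:
  fixes x b :: real
  assumes "x > 0" "0 \<le> b" "b \<le> 1"
  shows "exp (- x) \<le> x powr (- b)"
proof -
  have "x powr b \<le> (1 + x) powr b" using assms by (intro powr_mono2) auto
  also have "\<dots> \<le> (1 + x) powr 1" using assms by (intro powr_mono) auto
  also have "\<dots> \<le> exp x" using assms exp_ge_add_one_self[of x] by simp
  finally show ?thesis using assms by (simp add: exp_minus powr_minus field_simps)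
qed

text \<open>After the reflection x = t - \<tau>, the bound exp (- \<Lambda> x) \<le> (\<Lambda>
  x)^(-b) exchanges a little extra singularity at 0 for the factor \<Lambda>^(-b), which is small
  for large \<Lambda>.\<close>

lemma singular_kernel_laplace_small:
  fixes \<theta> T K :: real
  assumes \<theta>: "\<theta> < 1" and T: "T > 0" and K: "K \<ge> 0"
  shows "\<exists>\<Lambda>>0. \<forall>t. t \<le> T \<longrightarrow>
    (\<integral>\<^sup>+\<tau>. indicator {0<..<t} \<tau> * ennreal (K * (t - \<tau>) powr (- \<theta>) * exp (- \<Lambda> * (t - \<tau>))) \<partial>lborel) \<le> ennreal (1 / 2)"
proof -
  \<comment> \<open>The exponential bound asks for b \<le> 1; taking b at most half of 1 - \<theta>
    keeps x^(-\<theta>-b) integrable at 0.\<close>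
  define b where "b = min 1 ((1 - \<theta>) / 2)"
  have b: "0 < b" "b \<le> 1" "\<theta> + b < 1" using \<theta> by (auto simp: b_def min_def field_simps split: if_splits)
  define I where "I = T powr (1 - \<theta> - b) / (1 - \<theta> - b)"
  have I: "I \<ge> 0" using b by (simp add: I_def)
  have int: "(\<integral>\<^sup>+x. ennreal (x powr (- \<theta> - b)) * indicator {0..T} x \<partial>lborel) = ennreal I"
    using has_integral_powr_from_0[of "- \<theta> - b" T] b T
    by (intro nn_integral_has_integral_lebesgue') (auto simp: I_def algebra_simps)
  \<comment> \<open>Chosen so that \<Lambda>^(-b) = 1 / (2 K I + 1), whence K I \<Lambda>^(-b) \<le>
    1 / 2; the added 1 keeps the base positive when K * I = 0.\<close>
  define \<Lambda> where "\<Lambda> = (2 * K * I + 1) powr (1 / b)"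
  have "2 * K * I + 1 > 0" using K I by (simp add: add_nonneg_pos)
  then have \<Lambda>: "\<Lambda> > 0" "\<Lambda> powr (- b) = 1 / (2 * K * I + 1)"
    using b by (auto simp: \<Lambda>_def powr_powr powr_minus field_simps)
  show ?thesis
  proof (rule exI[of _ \<Lambda>], intro conjI allI impI)
    fix t assume t: "t \<le> T"
    let ?g = "\<lambda>\<tau>. indicator {0<..<t} \<tau> * ennreal (K * (t - \<tau>) powr (- \<theta>) * exp (- \<Lambda> * (t - \<tau>)))"
    have "(\<integral>\<^sup>+\<tau>. ?g \<tau> \<partial>lborel) = (\<integral>\<^sup>+\<tau>. ?g (t + (- 1) * \<tau>) \<partial>lborel)"
      by (subst nn_integral_real_affine[where c = "- 1" and t = t]) auto
    also have "\<dots> \<le> (\<integral>\<^sup>+x. ennreal (K * \<Lambda> powr (- b)) * (ennreal (x powr (- \<theta> - b)) * indicator {0..T} x) \<partial>lborel)"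
    proof (rule nn_integral_mono)
      fix x :: real
      show "?g (t + (- 1) * x) \<le> ennreal (K * \<Lambda> powr (- b)) * (ennreal (x powr (- \<theta> - b)) * indicator {0..T} x)"
      proof (cases "0 < x \<and> x < t")
        case True
        have "exp (- (\<Lambda> * x)) \<le> (\<Lambda> * x) powr (- b)"
          using True \<Lambda> b by (intro exp_minus_le_powr_minus) auto
        then have "K * x powr (- \<theta>) * exp (- (\<Lambda> * x)) \<le> K * x powr (- \<theta>) * (\<Lambda> * x) powr (- b)"
          using K by (intro mult_left_mono) auto
        also have "\<dots> = K * \<Lambda> powr (- b) * x powr (- \<theta> - b)"
          using True \<Lambda>(1) by (simp add: powr_mult powr_diff powr_minus field_simps)
        finally show ?thesis
          using True t K by (simp add: ennreal_mult[symmetric] ennreal_leI indicator_def)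
      qed (auto simp: indicator_def)
    qed
    also have "\<dots> = ennreal (K * \<Lambda> powr (- b)) * ennreal I"
      unfolding int[symmetric] by (rule nn_integral_cmult) simp
    also have "\<dots> = ennreal (K * I / (2 * K * I + 1))"
      using K I \<Lambda>(2) by (simp add: ennreal_mult[symmetric])
    also have "\<dots> \<le> ennreal (1 / 2)"
    proof (rule ennreal_leI)
      have "K * I \<ge> 0" using K I by simp
      then show "K * I / (2 * K * I + 1) \<le> 1 / 2" by (simp add: field_simps)
    qed
    finally show "(\<integral>\<^sup>+\<tau>. ?g \<tau> \<partial>lborel) \<le> ennreal (1 / 2)" .
  qed (rule \<Lambda>)
qed

text \<open>Measured against the weight exp (\<Lambda> t), the integral operator has norm at most 1
  / 2, because exp (\<Lambda> \<tau>) = exp (\<Lambda> t) exp (- \<Lambda> (t - \<tau>)). Starting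
  from the finite bound M, each iteration halves the estimate; the countably many exceptional null
  sets are merged before letting m tend to infinity.\<close>

lemma singular_gronwall_zero:
  fixes \<Phi> :: "real \<Rightarrow> ennreal" and K \<theta> T M :: real
  assumes [measurable]: "\<Phi> \<in> borel_measurable borel"
    and K: "K \<ge> 0" and \<theta>: "\<theta> < 1" and T: "T > 0" and M: "M \<ge> 0"
    and bound: "AE t in lborel. t \<in> {0<..<T} \<longrightarrow> \<Phi> t \<le> ennreal M"
    and step: "AE t in lborel. t \<in> {0<..<T} \<longrightarrow>
      \<Phi> t \<le> (\<integral>\<^sup>+\<tau>. indicator {0<..<t} \<tau> * ennreal (K * (t - \<tau>) powr (- \<theta>)) * \<Phi> \<tau> \<partial>lborel)"
  shows "AE t in lborel. t \<in> {0<..<T} \<longrightarrow> \<Phi> t = 0"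
proof -
  obtain \<Lambda> where \<Lambda>: "\<Lambda> > 0" "\<And>t. t \<le> T \<Longrightarrow>
    (\<integral>\<^sup>+\<tau>. indicator {0<..<t} \<tau> * ennreal (K * (t - \<tau>) powr (- \<theta>) * exp (- \<Lambda> * (t - \<tau>))) \<partial>lborel) \<le> ennreal (1 / 2)"
    using singular_kernel_laplace_small[OF \<theta> T K] by auto
  have iter: "AE t in lborel. t \<in> {0<..<T} \<longrightarrow> \<Phi> t \<le> ennreal (M * (1 / 2) ^ m * exp (\<Lambda> * t))" for m
  proof (induction m)
    case 0
    from bound show ?case
    proof eventually_elim
      case (elim t)
      have "M \<le> M * exp (\<Lambda> * t)" if "t > 0"
        using M \<Lambda> that by (simp add: mult_le_cancel_left1)
      then show ?case using elim by (auto intro: order_trans ennreal_leI)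
    qed
  next
    case (Suc m)
    let ?E = "M * (1 / 2) ^ m"
    from step show ?case
    proof eventually_elim
      case (elim t)
      show ?case
      proof
        assume t: "t \<in> {0<..<T}"
        have "\<Phi> t \<le> (\<integral>\<^sup>+\<tau>. indicator {0<..<t} \<tau> * ennreal (K * (t - \<tau>) powr (- \<theta>)) * \<Phi> \<tau> \<partial>lborel)"
          using elim t by blast
        also have "\<dots> \<le> (\<integral>\<^sup>+\<tau>. ennreal (?E * exp (\<Lambda> * t)) *
          (indicator {0<..<t} \<tau> * ennreal (K * (t - \<tau>) powr (- \<theta>) * exp (- \<Lambda> * (t - \<tau>)))) \<partial>lborel)"
        proof (rule nn_integral_mono_AE)
          from Suc.IH show "AE \<tau> in lborel. indicator {0<..<t} \<tau> * ennreal (K * (t - \<tau>) powr (- \<theta>)) * \<Phi> \<tau>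
            \<le> ennreal (?E * exp (\<Lambda> * t)) * (indicator {0<..<t} \<tau> * ennreal (K * (t - \<tau>) powr (- \<theta>) * exp (- \<Lambda> * (t - \<tau>))))"
          proof eventually_elim
            case (elim \<tau>)
            show ?case
            proof (cases "\<tau> \<in> {0<..<t}")
              case True
              then have "\<Phi> \<tau> \<le> ennreal (?E * exp (\<Lambda> * \<tau>))" using elim t by auto
              then have "ennreal (K * (t - \<tau>) powr (- \<theta>)) * \<Phi> \<tau>
                \<le> ennreal (K * (t - \<tau>) powr (- \<theta>)) * ennreal (?E * exp (\<Lambda> * \<tau>))"
                by (rule mult_left_mono) simp
              also have "\<dots> = ennreal (?E * exp (\<Lambda> * t)) * ennreal (K * (t - \<tau>) powr (- \<theta>) * exp (- \<Lambda> * (t - \<tau>)))"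
                using K M by (simp add: ennreal_mult[symmetric] exp_add[symmetric] mult_ac algebra_simps)
              finally show ?thesis using True by simp
            qed simp
          qed
        qed
        also have "\<dots> = ennreal (?E * exp (\<Lambda> * t)) *
          (\<integral>\<^sup>+\<tau>. indicator {0<..<t} \<tau> * ennreal (K * (t - \<tau>) powr (- \<theta>) * exp (- \<Lambda> * (t - \<tau>))) \<partial>lborel)"
          by (rule nn_integral_cmult) measurable
        also have "\<dots> \<le> ennreal (?E * exp (\<Lambda> * t)) * ennreal (1 / 2)"
          using t by (intro mult_left_mono \<Lambda>) auto
        also have "\<dots> = ennreal (?E * exp (\<Lambda> * t) * (1 / 2))"
          using M by (intro ennreal_mult[symmetric]) auto
        also have "\<dots> = ennreal (M * (1 / 2) ^ Suc m * exp (\<Lambda> * t))"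
          by (simp add: mult_ac)
        finally show "\<Phi> t \<le> ennreal (M * (1 / 2) ^ Suc m * exp (\<Lambda> * t))" .
      qed
    qed
  qed
  then have "AE t in lborel. \<forall>m. t \<in> {0<..<T} \<longrightarrow> \<Phi> t \<le> ennreal (M * (1 / 2) ^ m * exp (\<Lambda> * t))"
    by (simp only: AE_all_countable) simp
  then show ?thesis
  proof eventually_elim
    case (elim t)
    show ?case
    proof
      assume t: "t \<in> {0<..<T}"
      have "(\<lambda>m. M * (1 / 2) ^ m * exp (\<Lambda> * t)) \<longlonglongrightarrow> M * 0 * exp (\<Lambda> * t)"
        by (intro tendsto_intros LIMSEQ_power_zero) simp
      then have "(\<lambda>m. ennreal (M * (1 / 2) ^ m * exp (\<Lambda> * t))) \<longlonglongrightarrow> ennreal (M * 0 * exp (\<Lambda> * t))"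
        by (rule tendsto_ennrealI)
      then have "\<Phi> t \<le> ennreal (M * 0 * exp (\<Lambda> * t))"
        using elim t by (intro LIMSEQ_le_const) auto
      then show "\<Phi> t = 0" by simp
    qed
  qed
qed

subsection \<open>Differences of solutions\<close>

text \<open>For equal signs this is the mean value theorem for x^p, and for opposite signs a direct
  comparison; oddness of the power function reduces the remaining sign patterns to these.\<close>

lemma abs_powr_sgn_diff_le:
  fixes v w p :: real
  assumes p: "p > 1"
  shows "\<bar>\<bar>v\<bar> powr (p - 1) * v - \<bar>w\<bar> powr (p - 1) * w\<bar>
    \<le> p * (\<bar>v\<bar> powr (p - 1) + \<bar>w\<bar> powr (p - 1)) * \<bar>v - w\<bar>"
proof -
  \<comment> \<open>The derivative is largest at the bigger endpoint since p > 1. The case y = 0 is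
    computed directly, so that differentiation takes place at positive points only.\<close>
  have mvt: "x powr p - y powr p \<le> p * x powr (p - 1) * (x - y)" if "0 \<le> y" "y < x" for x y :: real
  proof (cases "y = 0")
    case True
    have "x powr p = x powr (p - 1) * x" using that by (simp add: powr_diff)
    then show ?thesis using True p that by (simp add: mult_le_cancel_right1)
  next
    case False
    then have y: "y > 0" using that by simp
    have "\<exists>z. z > y \<and> z < x \<and> x powr p - y powr p = (x - y) * (p * z powr (p - 1))"
      using that y by (intro MVT2) (auto intro!: derivative_eq_intros)
    then obtain z where z: "y < z" "z < x" "x powr p - y powr p = (x - y) * (p * z powr (p - 1))" by blast
    have "z powr (p - 1) \<le> x powr (p - 1)" using z y p by (intro powr_mono2) auto
    then have "(x - y) * (p * z powr (p - 1)) \<le> (x - y) * (p * x powr (p - 1))"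
      using that p by (intro mult_left_mono) auto
    then show ?thesis using z by (simp add: mult_ac)
  qed
  have sp: "\<bar>x\<bar> powr (p - 1) * x = x powr p" if "0 \<le> x" for x :: real
    using that by (cases "x = 0") (auto simp: powr_diff)
  have sn: "\<bar>x\<bar> powr (p - 1) * x = - ((- x) powr p)" if "x \<le> 0" for x :: real
    using sp[of "- x"] that by simp
  let ?R = "\<lambda>v w. p * (\<bar>v\<bar> powr (p - 1) + \<bar>w\<bar> powr (p - 1)) * \<bar>v - w\<bar>"
  have pos: "x powr p - y powr p \<le> ?R x y" "0 \<le> x powr p - y powr p" if "0 \<le> y" "y \<le> x" for x y :: real
  proof -
    show "x powr p - y powr p \<le> ?R x y"
    proof (cases "x = y")
      case False
      then have "x powr p - y powr p \<le> p * x powr (p - 1) * (x - y)" using mvt that by simp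
      also have "\<dots> \<le> ?R x y" using that p by (intro mult_mono) auto
      finally show ?thesis .
    qed simp
    show "0 \<le> x powr p - y powr p" using that p by (simp add: powr_mono2)
  qed
  \<comment> \<open>For opposite signs |v - w| is the sum of the moduli, so enlarging the last
    factor of each term and using p \<ge> 1 is enough.\<close>
  have opp: "x powr p + y powr p \<le> p * (x powr (p - 1) + y powr (p - 1)) * (x + y)" if "0 \<le> x" "0 \<le> y" for x y :: real
  proof -
    have "x powr p + y powr p = x powr (p - 1) * x + y powr (p - 1) * y"
      using sp[of x] sp[of y] that by simp
    also have "\<dots> \<le> x powr (p - 1) * (x + y) + y powr (p - 1) * (x + y)"
      using that by (intro add_mono mult_left_mono) auto
    also have "\<dots> = 1 * ((x powr (p - 1) + y powr (p - 1)) * (x + y))" by (simp add: algebra_simps)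
    also have "\<dots> \<le> p * ((x powr (p - 1) + y powr (p - 1)) * (x + y))"
      using that p by (intro mult_right_mono) auto
    finally show ?thesis by (simp add: mult_ac)
  qed
  consider "0 \<le> w" "w \<le> v" | "0 \<le> v" "v \<le> w" | "v \<le> 0" "w \<le> v" | "w \<le> 0" "v \<le> w"
    | "0 \<le> v" "w \<le> 0" | "v \<le> 0" "0 \<le> w" by linarith
  then show ?thesis
  proof cases
    case 1
    then show ?thesis using pos[of w v] sp[of v] sp[of w] by simp
  next
    case 2
    then show ?thesis using pos[of v w] sp[of v] sp[of w]
      by (simp add: abs_minus_commute add.commute)
  next
    case 3
    then show ?thesis using pos[of "- v" "- w"] sn[of v] sn[of w]
      by (simp add: abs_minus_commute add.commute)
  next
    case 4
    then show ?thesis using pos[of "- w" "- v"] sn[of v] sn[of w]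
      by (simp add: abs_minus_commute add.commute)
  next
    case 5
    then show ?thesis using opp[of v "- w"] sp[of v] sn[of w] by simp
  next
    case 6
    then have "\<bar>\<bar>v\<bar> powr (p - 1) * v - \<bar>w\<bar> powr (p - 1) * w\<bar> = (- v) powr p + w powr p"
      using sn[of v] sp[of w] powr_ge_zero[of "- v" p] powr_ge_zero[of w p] by linarith
    then show ?thesis using 6 opp[of "- v" w] by simp
  qed
qed

lemma measurable_pair_compose:
  assumes "case_prod u \<in> borel_measurable (borel \<Otimes>\<^sub>M borel)" "f \<in> measurable N borel" "g \<in> measurable N borel"
  shows "(\<lambda>z. u (f z) (g z)) \<in> borel_measurable N"
  using measurable_compose[OF measurable_Pair[OF assms(2,3)] assms(1)] by simp

text \<open>Tonelli makes the x integral innermost. Inserting exp (norm y) exp (- norm y) gives the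
  first factor to the x integral, where the bound k applies, and the second to the weighted mass of
  D at time \<tau>.\<close>

lemma heat_weighted_integral_le:
  fixes W :: "'a::euclidean_space \<Rightarrow> real" and D :: "real \<Rightarrow> 'a \<Rightarrow> real" and k :: "real \<Rightarrow> ennreal"
  assumes W [measurable]: "W \<in> borel_measurable borel" and W0: "\<And>x. W x \<ge> 0"
    and D: "case_prod D \<in> borel_measurable (borel \<Otimes>\<^sub>M borel)"
    and k: "\<And>\<tau> y. \<tau> \<in> {0<..<t} \<Longrightarrow>
      (\<integral>\<^sup>+x. ennreal (exp (norm y) * W x * heat_kernel (t - \<tau>) (x - y)) \<partial>lborel) \<le> k \<tau>"
  shows "(\<integral>\<^sup>+x. ennreal (W x) * (\<integral>\<^sup>+\<tau>. (\<integral>\<^sup>+y. ennreal (indicator {0<..<t} \<tau> * heat_kernel (t - \<tau>) (x - y) * \<bar>D \<tau> y\<bar>) \<partial>lborel) \<partial>lborel) \<partial>lborel)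
    \<le> (\<integral>\<^sup>+\<tau>. indicator {0<..<t} \<tau> * k \<tau> * (\<integral>\<^sup>+y. ennreal (exp (- norm y) * \<bar>D \<tau> y\<bar>) \<partial>lborel) \<partial>lborel)"
proof -
  note [measurable (raw)] = measurable_pair_compose[OF D]
  let ?P = "\<lambda>\<tau> x y. ennreal (W x) * ennreal (indicator {0<..<t} \<tau> * heat_kernel (t - \<tau>) (x - y) * \<bar>D \<tau> y\<bar>)"
  have "(\<integral>\<^sup>+x. ennreal (W x) * (\<integral>\<^sup>+\<tau>. (\<integral>\<^sup>+y. ennreal (indicator {0<..<t} \<tau> * heat_kernel (t - \<tau>) (x - y) * \<bar>D \<tau> y\<bar>) \<partial>lborel) \<partial>lborel) \<partial>lborel)
    = (\<integral>\<^sup>+x. (\<integral>\<^sup>+\<tau>. (\<integral>\<^sup>+y. ?P \<tau> x y \<partial>lborel) \<partial>lborel) \<partial>lborel)"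
    by (intro nn_integral_cong) (simp add: nn_integral_cmult)
  also have "\<dots> = (\<integral>\<^sup>+\<tau>. (\<integral>\<^sup>+x. (\<integral>\<^sup>+y. ?P \<tau> x y \<partial>lborel) \<partial>lborel) \<partial>lborel)"
    by (rule lborel_pair.Fubini') measurable
  also have "\<dots> = (\<integral>\<^sup>+\<tau>. (\<integral>\<^sup>+y. (\<integral>\<^sup>+x. ?P \<tau> x y \<partial>lborel) \<partial>lborel) \<partial>lborel)"
    by (intro nn_integral_cong lborel_pair.Fubini') measurable
  also have "\<dots> \<le> (\<integral>\<^sup>+\<tau>. indicator {0<..<t} \<tau> * k \<tau> * (\<integral>\<^sup>+y. ennreal (exp (- norm y) * \<bar>D \<tau> y\<bar>) \<partial>lborel) \<partial>lborel)"
  proof (rule nn_integral_mono)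
    fix \<tau> :: real
    show "(\<integral>\<^sup>+y. (\<integral>\<^sup>+x. ?P \<tau> x y \<partial>lborel) \<partial>lborel)
      \<le> indicator {0<..<t} \<tau> * k \<tau> * (\<integral>\<^sup>+y. ennreal (exp (- norm y) * \<bar>D \<tau> y\<bar>) \<partial>lborel)"
    proof (cases "\<tau> \<in> {0<..<t}")
      case True
      have "(\<integral>\<^sup>+y. (\<integral>\<^sup>+x. ?P \<tau> x y \<partial>lborel) \<partial>lborel)
        \<le> (\<integral>\<^sup>+y. k \<tau> * ennreal (exp (- norm y) * \<bar>D \<tau> y\<bar>) \<partial>lborel)"
      proof (rule nn_integral_mono)
        fix y :: 'a
        have "(\<integral>\<^sup>+x. ?P \<tau> x y \<partial>lborel)
          = (\<integral>\<^sup>+x. ennreal (exp (- norm y) * \<bar>D \<tau> y\<bar>) * ennreal (exp (norm y) * W x * heat_kernel (t - \<tau>) (x - y)) \<partial>lborel)"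
          using True W0 by (intro nn_integral_cong)
            (simp add: ennreal_mult[symmetric] heat_kernel_nonneg exp_minus field_simps)
        also have "\<dots> = ennreal (exp (- norm y) * \<bar>D \<tau> y\<bar>) * (\<integral>\<^sup>+x. ennreal (exp (norm y) * W x * heat_kernel (t - \<tau>) (x - y)) \<partial>lborel)"
          by (rule nn_integral_cmult) measurable
        also have "\<dots> \<le> ennreal (exp (- norm y) * \<bar>D \<tau> y\<bar>) * k \<tau>"
          by (intro mult_left_mono k True) simp
        finally show "(\<integral>\<^sup>+x. ?P \<tau> x y \<partial>lborel) \<le> k \<tau> * ennreal (exp (- norm y) * \<bar>D \<tau> y\<bar>)"
          by (simp add: mult.commute)
      qed
      also have "\<dots> = k \<tau> * (\<integral>\<^sup>+y. ennreal (exp (- norm y) * \<bar>D \<tau> y\<bar>) \<partial>lborel)"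
        by (rule nn_integral_cmult) measurable
      finally show ?thesis using True by simp
    qed simp
  qed
  finally show ?thesis .
qed

lemma hh_nonlin_measurable [measurable (raw)]:
  fixes g :: "'b \<Rightarrow> 'a::euclidean_space"
  assumes [measurable]: "g \<in> borel_measurable N" "f \<in> borel_measurable N"
  shows "(\<lambda>z. hh_nonlin \<gamma> \<alpha> (g z) (f z)) \<in> borel_measurable N"
  unfolding hh_nonlin_def by measurable

lemma abs_hh_nonlin_diff_le:
  assumes "\<alpha> > 1"
  shows "\<bar>hh_nonlin \<gamma> \<alpha> y v - hh_nonlin \<gamma> \<alpha> y w\<bar>
    \<le> \<alpha> * norm y powr \<gamma> * (\<bar>v\<bar> powr (\<alpha> - 1) + \<bar>w\<bar> powr (\<alpha> - 1)) * \<bar>v - w\<bar>"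
proof -
  have "hh_nonlin \<gamma> \<alpha> y v - hh_nonlin \<gamma> \<alpha> y w
    = norm y powr \<gamma> * (\<bar>v\<bar> powr (\<alpha> - 1) * v - \<bar>w\<bar> powr (\<alpha> - 1) * w)"
    by (simp add: hh_nonlin_def algebra_simps)
  then show ?thesis
    using mult_left_mono[OF abs_powr_sgn_diff_le[OF assms, of v w], of "norm y powr \<gamma>"]
    by (simp add: abs_mult mult_ac)
qed

lemma abs_hh_nonlin:
  assumes "\<alpha> > 1"
  shows "\<bar>hh_nonlin \<gamma> \<alpha> y v\<bar> = norm y powr \<gamma> * \<bar>v\<bar> powr \<alpha>"
  using assms by (cases "v = 0") (auto simp: hh_nonlin_def abs_mult powr_diff)

text \<open>The terms \<open>heat t u0\<close> cancel, and the integrability contained in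
  \<open>hh_solution\<close> permits subtracting the Duhamel integrals. The estimate holds at every
  t of the interval, which is used in the last step of the uniqueness proof.\<close>

lemma hh_solution_diff_le:
  fixes u1 u2 :: "real \<Rightarrow> 'a::euclidean_space \<Rightarrow> real"
  assumes u: "hh_solution \<gamma> \<alpha> T u0 u1" "hh_solution \<gamma> \<alpha> T u0 u2"
    and meas: "case_prod u1 \<in> borel_measurable (borel \<Otimes>\<^sub>M borel)" "case_prod u2 \<in> borel_measurable (borel \<Otimes>\<^sub>M borel)"
    and t: "t \<in> {0<..<T}"
  shows "AE x in lborel. ennreal \<bar>u1 t x - u2 t x\<bar> \<le>
    (\<integral>\<^sup>+\<tau>. (\<integral>\<^sup>+y. ennreal (indicator {0<..<t} \<tau> * heat_kernel (t - \<tau>) (x - y) *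
        \<bar>hh_nonlin \<gamma> \<alpha> y (u1 \<tau> y) - hh_nonlin \<gamma> \<alpha> y (u2 \<tau> y)\<bar>) \<partial>lborel) \<partial>lborel)"
proof -
  note [measurable (raw)] = measurable_pair_compose[OF meas(1)] measurable_pair_compose[OF meas(2)]
  have "AE x in lborel. integrable (lborel \<Otimes>\<^sub>M lborel) (duhamel_integrand \<gamma> \<alpha> u1 t x) \<and>
        u1 t x = heat t u0 x + (\<integral> p. duhamel_integrand \<gamma> \<alpha> u1 t x p \<partial>(lborel \<Otimes>\<^sub>M lborel))"
    using u(1) t unfolding hh_solution_def by (auto elim!: ballE[where x = t] eventually_mono)
  moreover have "AE x in lborel. integrable (lborel \<Otimes>\<^sub>M lborel) (duhamel_integrand \<gamma> \<alpha> u2 t x) \<and>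
        u2 t x = heat t u0 x + (\<integral> p. duhamel_integrand \<gamma> \<alpha> u2 t x p \<partial>(lborel \<Otimes>\<^sub>M lborel))"
    using u(2) t unfolding hh_solution_def by (auto elim!: ballE[where x = t] eventually_mono)
  ultimately show ?thesis
  proof eventually_elim
    case (elim x)
    let ?F = "\<lambda>p. duhamel_integrand \<gamma> \<alpha> u1 t x p - duhamel_integrand \<gamma> \<alpha> u2 t x p"
    have "u1 t x - u2 t x = (\<integral> p. ?F p \<partial>(lborel \<Otimes>\<^sub>M lborel))"
      using elim by simp
    then have "ennreal \<bar>u1 t x - u2 t x\<bar> \<le> (\<integral>\<^sup>+p. ennreal \<bar>?F p\<bar> \<partial>(lborel \<Otimes>\<^sub>M lborel))"
      using elim integral_norm_bound_ennreal[of "lborel \<Otimes>\<^sub>M lborel" ?F] by simp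
    also have "\<dots> = (\<integral>\<^sup>+p. (case p of (\<tau>, y) \<Rightarrow> ennreal (indicator {0<..<t} \<tau> * heat_kernel (t - \<tau>) (x - y) *
        \<bar>hh_nonlin \<gamma> \<alpha> y (u1 \<tau> y) - hh_nonlin \<gamma> \<alpha> y (u2 \<tau> y)\<bar>)) \<partial>(lborel \<Otimes>\<^sub>M lborel))"
      by (intro nn_integral_cong)
        (auto simp: duhamel_integrand_def right_diff_distrib[symmetric] abs_mult heat_kernel_nonneg indicator_def)
    also have "\<dots> = (\<integral>\<^sup>+\<tau>. (\<integral>\<^sup>+y. ennreal (indicator {0<..<t} \<tau> * heat_kernel (t - \<tau>) (x - y) *
        \<bar>hh_nonlin \<gamma> \<alpha> y (u1 \<tau> y) - hh_nonlin \<gamma> \<alpha> y (u2 \<tau> y)\<bar>) \<partial>lborel) \<partial>lborel)"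
      by (subst lborel.nn_integral_fst[symmetric]) (simp_all, measurable)
    finally show ?case .
  qed
qed

theorem theorem1p1:
  fixes \<gamma> \<alpha> s T :: real and q r :: ereal
    and u0 :: "'a::euclidean_space \<Rightarrow> real" and u1 u2 :: "real \<Rightarrow> 'a \<Rightarrow> real"
  defines "n \<equiv> real DIM('a)"
  assumes "\<alpha> > 1" and "T > 0"
    and "\<gamma> > - min 2 n"
    and "\<alpha> \<ge> max 1 (1 + \<gamma> / n)"
    and "\<gamma> / (\<alpha> - 1) \<le> s" and "s \<le> n"
    and "ereal \<alpha> \<le> q" and "1 \<le> q"
    and "0 < r"
    and "ereal (s / n) + 1 / q > 0 \<or> (ereal (s / n) + 1 / q = 0 \<and> r = \<infinity>)"
    and "ereal (s / n) + 1 / q < 1 \<or> (ereal (s / n) + 1 / q = 1 \<and> r \<le> 1)"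
    and "ereal (s / n) + 1 / q < ereal (min ((2 + \<gamma>) / (n * (\<alpha> - 1))) ((n + \<gamma>) / (n * \<alpha>)))
         \<or> (ereal (s / n) + 1 / q = ereal ((n + \<gamma>) / (n * \<alpha>))
            \<and> (n + \<gamma>) / (n * \<alpha>) < (2 + \<gamma>) / (n * (\<alpha> - 1)) \<and> r \<le> ereal \<alpha>)"
    and "u1 \<in> Linf_herz T s q r" and "u2 \<in> Linf_herz T s q r"
    and "hh_solution \<gamma> \<alpha> T u0 u1" and "hh_solution \<gamma> \<alpha> T u0 u2"
  shows "AE t in lborel. t \<in> {0<..<T} \<longrightarrow> (AE x in lborel. u1 t x = u2 t x)"
proof -

  \<comment> \<open>The exponent conditions in real form\<close>
  have n: "n > 0" by (simp add: n_def)
  define b where "b = real_of_ereal (1 / q)"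
  have q: "1 / q = ereal b"
    using assms(2,8) by (cases q) (auto simp: b_def one_ereal_def)
  define B where "B = s / n + b"
  have eB: "ereal (s / n) + 1 / q = ereal B" by (simp add: q B_def)
  have B0: "B \<ge> 0"
    using assms(11) unfolding eB by (auto simp: zero_ereal_def)
  \<comment> \<open>In the borderline alternative the strict bound by 1/q_c comes from the ordering
    of the two thresholds, and the bound by 1/Q_c is an equality with r \<le> \<alpha>.\<close>
  have subcrit: "B < (2 + \<gamma>) / (n * (\<alpha> - 1))"
    and mass: "B < (n + \<gamma>) / (n * \<alpha>) \<or> B = (n + \<gamma>) / (n * \<alpha>) \<and> r \<le> ereal \<alpha>"
    using assms(13) unfolding eB by auto
  have nB: "n * B = s + n * b" using n by (simp add: B_def field_simps)
  have "(\<alpha> - 1) * (n * B) < 2 + \<gamma>"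
    using subcrit n assms(2) by (simp add: field_simps)
  then have subcrit': "(\<alpha> - 1) * s + n * ((\<alpha> - 1) * b) < 2 + \<gamma>"
    unfolding nB by (simp add: algebra_simps)
  have "\<alpha> * (n * B) < n + \<gamma> \<or> \<alpha> * (n * B) = n + \<gamma> \<and> r \<le> ereal \<alpha>"
    using mass n assms(2) by (auto simp: field_simps)
  \<comment> \<open>This is the condition on \<mu> in \<open>herz_weighted_mass\<close> with a =
    \<alpha>.\<close>
  then have mass': "n * (1 - \<alpha> * b) - \<alpha> * s + \<gamma> > 0 \<or> n * (1 - \<alpha> * b) - \<alpha> * s + \<gamma> = 0 \<and> r \<le> ereal \<alpha>"
    unfolding nB by (auto simp: algebra_simps)
  \<comment> \<open>This is the sign condition of \<open>herz_kato_bound\<close> with a = \<alpha> -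
    1.\<close>
  have weight: "(\<alpha> - 1) * s \<ge> \<gamma>"
    using assms(2,6) by (simp add: field_simps)
  \<comment> \<open>Below \<open>1\<close> because the mass condition bounds the sum of this exponent and \<open>B \<ge> 0\<close>
    by \<open>1\<close>; when \<open>B = 0\<close> it equals \<open>- \<gamma> / n\<close>.\<close>
  have potential: "(\<alpha> - 1) * b + ((\<alpha> - 1) * s - \<gamma>) / n < min 1 (2 / n)"
  proof -
    have "(\<alpha> - 1) * s + n * ((\<alpha> - 1) * b) < n + \<gamma>"
    proof (cases "B = 0")
      case True
      then have "s = - n * b" using n by (simp add: B_def field_simps)
      then have "(\<alpha> - 1) * s + n * ((\<alpha> - 1) * b) = 0" by (simp add: algebra_simps)
      then show ?thesis using assms(4) by (simp add: min_def split: if_splits)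
    next
      case False
      then have "0 < n * B" using B0 n by simp
      also note nB
      finally show ?thesis using mass' by (auto simp: algebra_simps)
    qed
    then have "((\<alpha> - 1) * s + n * ((\<alpha> - 1) * b) - \<gamma>) / n < min 1 (2 / n)"
      using subcrit' n by (simp add: divide_less_eq divide_strict_right_mono)
    moreover have "(\<alpha> - 1) * b + ((\<alpha> - 1) * s - \<gamma>) / n = ((\<alpha> - 1) * s + n * ((\<alpha> - 1) * b) - \<gamma>) / n"
      using n by (simp add: field_simps)
    ultimately show ?thesis by simp
  qed
  \<comment> \<open>The potential carries the power \<alpha> - 1, so the strict inequality of the
    Kato bound holds even at q = \<alpha>.\<close>
  have \<alpha>q: "ereal (\<alpha> - 1) < q"
    using assms(8) by (cases q) auto

  \<comment> \<open>Mass and potential bounds common to both solutions\<close>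
  obtain C1 C2 where C12:
    "AE t in lborel. t \<in> {0<..<T} \<longrightarrow> herz_norm s q r (u1 t) \<le> ennreal C1"
    "AE t in lborel. t \<in> {0<..<T} \<longrightarrow> herz_norm s q r (u2 t) \<le> ennreal C2"
    using assms(14,15) unfolding Linf_herz_def by auto
  define C where "C = max 0 (max C1 C2)"
  have C: "C \<ge> 0" "ennreal C1 \<le> ennreal C" "ennreal C2 \<le> ennreal C"
    by (auto simp: C_def intro!: ennreal_leI)
  have herz: "AE t in lborel. t \<in> {0<..<T} \<longrightarrow> herz_norm s q r (u1 t) \<le> ennreal C \<and> herz_norm s q r (u2 t) \<le> ennreal C"
    using C12 by eventually_elim (use C in \<open>auto intro: order_trans\<close>)
  have "sets (lborel \<Otimes>\<^sub>M lborel :: (real \<times> 'a) measure) = sets (borel \<Otimes>\<^sub>M borel)"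
    by (intro sets_pair_measure_cong) auto
  then have um: "case_prod u1 \<in> borel_measurable (borel \<Otimes>\<^sub>M borel)" "case_prod u2 \<in> borel_measurable (borel \<Otimes>\<^sub>M borel)"
    using assms(14,15) unfolding Linf_herz_def by (auto cong: measurable_cong_sets)
  note [measurable (raw)] = measurable_pair_compose[OF um(1)] measurable_pair_compose[OF um(2)]
  obtain K1 where K1: "K1 \<ge> 0" "\<And>f::'a \<Rightarrow> real. f \<in> borel_measurable borel \<Longrightarrow> herz_norm s q r f \<le> ennreal C \<Longrightarrow>
    (\<integral>\<^sup>+x. ennreal (exp (- norm x) * norm x powr \<gamma> * \<bar>f x\<bar> powr \<alpha>) \<partial>lborel) \<le> ennreal K1"
    using herz_weighted_mass[of \<alpha> q r C s \<gamma>, where ?'a = 'a] assms(2,8,10) C(1) mass'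
    unfolding n_def b_def by auto
  obtain K2 \<theta> where K2: "K2 \<ge> 0" "\<theta> < 1" "\<And>(f::'a \<Rightarrow> real) t y. f \<in> borel_measurable borel \<Longrightarrow>
    herz_norm s q r f \<le> ennreal C \<Longrightarrow> 0 < t \<Longrightarrow> t \<le> T \<Longrightarrow>
    (\<integral>\<^sup>+x. ennreal (exp (norm y - norm x) * norm x powr \<gamma> * \<bar>f x\<bar> powr (\<alpha> - 1) * heat_kernel t (x - y)) \<partial>lborel)
      \<le> ennreal (K2 * t powr (- \<theta>))"
    using herz_kato_bound[of "\<alpha> - 1" q r C T \<gamma> s, where ?'a = 'a] assms(2,3,10) \<alpha>q C(1) weight potential
    unfolding n_def b_def by auto

  \<comment> \<open>The functional \<Phi> and its singular integral inequality\<close>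
  define D where "D \<tau> y = hh_nonlin \<gamma> \<alpha> y (u1 \<tau> y) - hh_nonlin \<gamma> \<alpha> y (u2 \<tau> y)" for \<tau> y
  have D: "case_prod D \<in> borel_measurable (borel \<Otimes>\<^sub>M borel)"
    unfolding D_def case_prod_beta by measurable
  note [measurable (raw)] = measurable_pair_compose[OF D]
  define \<Phi> where "\<Phi> t = (\<integral>\<^sup>+y. ennreal (exp (- norm y) * \<bar>D t y\<bar>) \<partial>lborel)" for t
  have \<Phi>: "\<Phi> \<in> borel_measurable borel"
    unfolding \<Phi>_def by measurable
  \<comment> \<open>The finite a priori bound that starts the Gronwall iteration; each solution
    contributes one \<open>K1\<close>.\<close>
  have bound: "AE t in lborel. t \<in> {0<..<T} \<longrightarrow> \<Phi> t \<le> ennreal (K1 + K1)"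
    using herz
  proof eventually_elim
    case (elim t)
    show ?case
    proof
      assume t: "t \<in> {0<..<T}"
      have "\<Phi> t \<le> (\<integral>\<^sup>+y. ennreal (exp (- norm y) * norm y powr \<gamma> * \<bar>u1 t y\<bar> powr \<alpha>)
          + ennreal (exp (- norm y) * norm y powr \<gamma> * \<bar>u2 t y\<bar> powr \<alpha>) \<partial>lborel)"
        unfolding \<Phi>_def
      proof (rule nn_integral_mono)
        fix y :: 'a
        have "\<bar>D t y\<bar> \<le> norm y powr \<gamma> * \<bar>u1 t y\<bar> powr \<alpha> + norm y powr \<gamma> * \<bar>u2 t y\<bar> powr \<alpha>"
          unfolding D_def abs_hh_nonlin[OF assms(2), symmetric] by (rule abs_triangle_ineq4)
        then have "exp (- norm y) * \<bar>D t y\<bar> \<le> exp (- norm y) * (norm y powr \<gamma> * \<bar>u1 t y\<bar> powr \<alpha> + norm y powr \<gamma> * \<bar>u2 t y\<bar> powr \<alpha>)"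
          by (rule mult_left_mono) simp
        then have "ennreal (exp (- norm y) * \<bar>D t y\<bar>) \<le> ennreal (exp (- norm y) * norm y powr \<gamma> * \<bar>u1 t y\<bar> powr \<alpha>
          + exp (- norm y) * norm y powr \<gamma> * \<bar>u2 t y\<bar> powr \<alpha>)"
          by (intro ennreal_leI) (simp add: algebra_simps)
        then show "ennreal (exp (- norm y) * \<bar>D t y\<bar>) \<le> ennreal (exp (- norm y) * norm y powr \<gamma> * \<bar>u1 t y\<bar> powr \<alpha>)
          + ennreal (exp (- norm y) * norm y powr \<gamma> * \<bar>u2 t y\<bar> powr \<alpha>)"
          by simp
      qed
      also have "\<dots> = (\<integral>\<^sup>+y. ennreal (exp (- norm y) * norm y powr \<gamma> * \<bar>u1 t y\<bar> powr \<alpha>) \<partial>lborel)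
          + (\<integral>\<^sup>+y. ennreal (exp (- norm y) * norm y powr \<gamma> * \<bar>u2 t y\<bar> powr \<alpha>) \<partial>lborel)"
        by (rule nn_integral_add) measurable
      also have "\<dots> \<le> ennreal K1 + ennreal K1"
        using elim t by (intro add_mono K1) (auto, measurable)
      finally show "\<Phi> t \<le> ennreal (K1 + K1)"
        using K1(1) by (simp add: ennreal_plus[symmetric] del: ennreal_plus)
    qed
  qed
  have step: "AE t in lborel. t \<in> {0<..<T} \<longrightarrow>
    \<Phi> t \<le> (\<integral>\<^sup>+\<tau>. indicator {0<..<t} \<tau> * ennreal (\<alpha> * (K2 + K2) * (t - \<tau>) powr (- \<theta>)) * \<Phi> \<tau> \<partial>lborel)"
    using herz
  proof eventually_elim
    case (elim t)
    show ?case
    proof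
      assume t: "t \<in> {0<..<T}"
      let ?R = "\<lambda>x. \<integral>\<^sup>+\<tau>. (\<integral>\<^sup>+y. ennreal (indicator {0<..<t} \<tau> * heat_kernel (t - \<tau>) (x - y) * \<bar>D \<tau> y\<bar>) \<partial>lborel) \<partial>lborel"
      \<comment> \<open>The potential is frozen at the outer time t, so the spatial Kato bound
        applies for almost every t, with kernel time t - \<tau> \<le> T.\<close>
      define W where "W x = exp (- norm x) * (\<alpha> * norm x powr \<gamma> * (\<bar>u1 t x\<bar> powr (\<alpha> - 1) + \<bar>u2 t x\<bar> powr (\<alpha> - 1)))" for x
      have W: "W \<in> borel_measurable borel" "\<And>x. W x \<ge> 0"
        using assms(2) unfolding W_def by (measurable, simp)
      have "\<Phi> t \<le> (\<integral>\<^sup>+x. ennreal (W x) * ?R x \<partial>lborel)"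
        unfolding \<Phi>_def
      proof (rule nn_integral_mono_AE)
        have "AE x in lborel. ennreal \<bar>u1 t x - u2 t x\<bar> \<le> ?R x"
          using hh_solution_diff_le[OF assms(16,17) um t] by (simp only: D_def)
        then show "AE x in lborel. ennreal (exp (- norm x) * \<bar>D t x\<bar>) \<le> ennreal (W x) * ?R x"
        proof eventually_elim
          case (elim x)
          have "exp (- norm x) * \<bar>D t x\<bar> \<le> exp (- norm x) * (\<alpha> * norm x powr \<gamma> *
            (\<bar>u1 t x\<bar> powr (\<alpha> - 1) + \<bar>u2 t x\<bar> powr (\<alpha> - 1)) * \<bar>u1 t x - u2 t x\<bar>)"
            unfolding D_def by (intro mult_left_mono abs_hh_nonlin_diff_le assms(2)) simp
          then have "ennreal (exp (- norm x) * \<bar>D t x\<bar>) \<le> ennreal (W x * \<bar>u1 t x - u2 t x\<bar>)"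
            by (intro ennreal_leI) (simp add: W_def mult.assoc)
          also have "\<dots> = ennreal (W x) * ennreal \<bar>u1 t x - u2 t x\<bar>"
            using W by (intro ennreal_mult) auto
          also have "\<dots> \<le> ennreal (W x) * ?R x"
            using elim by (rule mult_left_mono) simp
          finally show ?case .
        qed
      qed
      also have "\<dots> \<le> (\<integral>\<^sup>+\<tau>. indicator {0<..<t} \<tau> * ennreal (\<alpha> * (K2 + K2) * (t - \<tau>) powr (- \<theta>)) * \<Phi> \<tau> \<partial>lborel)"
        unfolding \<Phi>_def
      proof (rule heat_weighted_integral_le[OF W D])
        fix \<tau> and y :: 'a
        assume \<tau>: "\<tau> \<in> {0<..<t}"
        let ?g = "\<lambda>u x. ennreal (exp (norm y - norm x) * norm x powr \<gamma> * \<bar>u t x\<bar> powr (\<alpha> - 1) * heat_kernel (t - \<tau>) (x - y))"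
        have "(\<integral>\<^sup>+x. ennreal (exp (norm y) * W x * heat_kernel (t - \<tau>) (x - y)) \<partial>lborel)
          = (\<integral>\<^sup>+x. ennreal \<alpha> * (?g u1 x + ?g u2 x) \<partial>lborel)"
        proof (intro nn_integral_cong)
          fix x :: 'a
          have "exp (norm y) * W x * heat_kernel (t - \<tau>) (x - y)
            = \<alpha> * (exp (norm y - norm x) * norm x powr \<gamma> * \<bar>u1 t x\<bar> powr (\<alpha> - 1) * heat_kernel (t - \<tau>) (x - y)
              + exp (norm y - norm x) * norm x powr \<gamma> * \<bar>u2 t x\<bar> powr (\<alpha> - 1) * heat_kernel (t - \<tau>) (x - y))"
            by (simp add: W_def exp_diff exp_minus field_simps)
          then show "ennreal (exp (norm y) * W x * heat_kernel (t - \<tau>) (x - y)) = ennreal \<alpha> * (?g u1 x + ?g u2 x)"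
            using assms(2) by (simp add: ennreal_mult ennreal_plus heat_kernel_nonneg del: ennreal_plus[symmetric])
        qed
        also have "\<dots> = ennreal \<alpha> * ((\<integral>\<^sup>+x. ?g u1 x \<partial>lborel) + (\<integral>\<^sup>+x. ?g u2 x \<partial>lborel))"
          by (subst nn_integral_cmult, measurable, subst nn_integral_add, measurable)
        also have "\<dots> \<le> ennreal \<alpha> * (ennreal (K2 * (t - \<tau>) powr (- \<theta>)) + ennreal (K2 * (t - \<tau>) powr (- \<theta>)))"
          using elim t \<tau> by (intro mult_left_mono add_mono K2) (auto, measurable)
        also have "\<dots> = ennreal (\<alpha> * (K2 + K2) * (t - \<tau>) powr (- \<theta>))"
          using assms(2) K2(1) by (simp add: ennreal_mult[symmetric] ennreal_plus[symmetric] algebra_simps del: ennreal_plus)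
        finally show "(\<integral>\<^sup>+x. ennreal (exp (norm y) * W x * heat_kernel (t - \<tau>) (x - y)) \<partial>lborel)
          \<le> ennreal (\<alpha> * (K2 + K2) * (t - \<tau>) powr (- \<theta>))" .
      qed
      finally show "\<Phi> t \<le> (\<integral>\<^sup>+\<tau>. indicator {0<..<t} \<tau> * ennreal (\<alpha> * (K2 + K2) * (t - \<tau>) powr (- \<theta>)) * \<Phi> \<tau> \<partial>lborel)" .
    qed
  qed

  \<comment> \<open>From the vanishing of \<Phi> to equality of the solutions\<close>
  have zero: "AE t in lborel. t \<in> {0<..<T} \<longrightarrow> \<Phi> t = 0"
    by (rule singular_gronwall_zero[OF \<Phi> _ K2(2) assms(3) _ bound step]) (use K1 K2 assms(2) in auto)
  \<comment> \<open>\<Phi> vanishes only for almost every \<tau>, but it enters the Duhamel estimate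
    through an integral over \<tau>, so equality follows at every t of the interval.\<close>
  show ?thesis
  proof (rule AE_I2, rule impI)
    fix t assume t: "t \<in> {0<..<T}"
    show "AE x in lborel. u1 t x = u2 t x"
      using hh_solution_diff_le[OF assms(16,17) um t]
    proof eventually_elim
      case (elim x)
      have "(\<integral>\<^sup>+\<tau>. (\<integral>\<^sup>+y. ennreal (indicator {0<..<t} \<tau> * heat_kernel (t - \<tau>) (x - y) * \<bar>D \<tau> y\<bar>) \<partial>lborel) \<partial>lborel)
        = (\<integral>\<^sup>+\<tau>. 0 \<partial>(lborel :: real measure))"
      proof (rule nn_integral_cong_AE)
        from zero show "AE \<tau> in lborel.
          (\<integral>\<^sup>+y. ennreal (indicator {0<..<t} \<tau> * heat_kernel (t - \<tau>) (x - y) * \<bar>D \<tau> y\<bar>) \<partial>lborel) = 0"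
        proof eventually_elim
          case (elim \<tau>)
          show ?case
          proof (cases "\<tau> \<in> {0<..<t}")
            case True
            then have "\<Phi> \<tau> = 0" using elim t by auto
            \<comment> \<open>The weight exp (- norm y) is positive, so \<open>D \<tau>\<close>
              itself vanishes almost everywhere.\<close>
            then have "AE y in lborel. ennreal (exp (- norm y) * \<bar>D \<tau> y\<bar>) = 0"
              unfolding \<Phi>_def by (subst (asm) nn_integral_0_iff_AE) (auto, measurable)
            then show ?thesis
              by (subst nn_integral_0_iff_AE, measurable)
                (auto elim!: eventually_mono simp: ennreal_eq_0_iff mult_le_0_iff)
          qed simp
        qed
      qed
      then show ?case using elim by (simp add: D_def ennreal_eq_0_iff)
    qed
  qed
qed

end
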